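(* For every integer $n\ge 4$, the full-flag Johnson graph $FJ(n,2)$ has the Aldous property. Explicitly: identifying $FJ(n,2)$ with the Cayley graph $\operatorname{Cay}(S_n,\mathcal R_n(2))$, the second-largest adjacency eigenvalue of $\operatorname{Cay}(S_n,\mathcal R_n(2))$ equals the second-largest eigenvalue of the adjacency matrix of the Schreier graph $\operatorname{Sch}(S_n,[n],\mathcal R_n(2))$.
   Context: A full flag of $[n]=\{1,\dots,n\}$ is a chain $U=(U_1,\dots,U_n)$ of subsets with $|U_i|=i$ and $U_i\subset U_{i+1}$. The full-flag Johnson graph $FJ(n,k)$ has the full flags of $[n]$ as vertices, with $U,V$ adjacent iff $|\{i\in[n]: U_i\ne V_i\}|=k$. A permutation $\sigma\in S_n$ is $m$-reducible if there is a partition $[n]=I_1\cup\dots\cup I_m$ into contiguous intervals with $\sigma(I_j)=I_j$ for all $j$; it is maximally $m$-reducible if $m$ is the largest such integer. $\mathcal R_n(k)$ is the set of maximally $(n-k)$-reducible permutations in $S_n$; $FJ(n,k)\cong\operatorname{Cay}(S_n,\mathcal R_n(k))$. For $\Sigma\subseteq G$ closed under inverses and not containing the identity, $\operatorname{Cay}(G,\Sigma)$ has vertex set $G$, with $g,h$ adjacent iff $h=\sigma g$ for some $\sigma\in\Sigma$. The Schreier graph $\operatorname{Sch}(S_n,[n],\Sigma)$ has vertex set $[n]$ and one arc from $i$ to $j$ for each $\sigma\in\Sigma$ with $\sigma(i)=j$ (its adjacency matrix has $(i,j)$-entry equal to the number of such $\sigma$). A Cayley graph $\operatorname{Cay}(S_n,\Sigma)$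 has the Aldous property if its second-largest eigenvalue equals that of $\operatorname{Sch}(S_n,[n],\Sigma)$. *)

theory Defs
  imports
    "HOL-Library.Disjoint_Sets"
    "HOL-Library.FuncSet"
    "HOL-Algebra.Sym_Groups"
    "Graph_Theory.Graph_Theory"
    "Jordan_Normal_Form.Char_Poly"
begin

section \<open>Full-flag Johnson graphs\<close>

definition full_flags :: "nat \<Rightarrow> (nat \<Rightarrow> nat set) set" where
  "full_flags n = {U \<in> {1..n} \<rightarrow>\<^sub>E Pow {1..n}.
     (\<forall>i\<in>{1..n}. card (U i) = i) \<and> (\<forall>i\<in>{1..<n}. U i \<subset> U (Suc i))}"

text \<open>Undirected simple graphs are symmetric digraphs without parallel arcs, as usual in
  \<^theory>\<open>Graph_Theory.Digraph\<close>.\<close>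

definition FJ :: "nat \<Rightarrow> nat \<Rightarrow> (nat \<Rightarrow> nat set) pair_pre_digraph" where
  "FJ n k = \<lparr> pverts = full_flags n,
     parcs = {(U, V). U \<in> full_flags n \<and> V \<in> full_flags n \<and> card {i \<in> {1..n}. U i \<noteq> V i} = k} \<rparr>"

section \<open>Reducible permutations\<close>

definition reducible :: "nat \<Rightarrow> nat \<Rightarrow> (nat \<Rightarrow> nat) \<Rightarrow> bool" where
  "reducible n m \<sigma> \<longleftrightarrow> (\<exists>P. partition_on {1..n} P \<and> card P = m \<and>
     (\<forall>I\<in>P. (\<exists>a b. I = {a..b}) \<and> \<sigma> ` I = I))"

definition maximally_reducible :: "nat \<Rightarrow> nat \<Rightarrow> (nat \<Rightarrow> nat) \<Rightarrow> bool" where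
  "maximally_reducible n m \<sigma> \<longleftrightarrow> reducible n m \<sigma> \<and> (\<forall>m'. reducible n m' \<sigma> \<longrightarrow> m' \<le> m)"

text \<open>The set \<open>R\<^sub>n(k)\<close>, meant for \<open>k \<le> n\<close> only, since \<open>n - k\<close> truncates.\<close>

definition maximally_reducible_perms :: "nat \<Rightarrow> nat \<Rightarrow> (nat \<Rightarrow> nat) set" where
  "maximally_reducible_perms n k = {\<sigma>. \<sigma> permutes {1..n} \<and> maximally_reducible n (n - k) \<sigma>}"

section \<open>Cayley and Schreier graphs\<close>

text \<open>\<open>S\<close> is meant to be a subset of the group closed under inverses and without the identity,
  so that the Cayley graph is a simple graph.\<close>

definition cayley_graph :: "('a, 'b) monoid_scheme \<Rightarrow> 'a set \<Rightarrow> 'a pair_pre_digraph" where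
  "cayley_graph G S = \<lparr> pverts = carrier G,
     parcs = {(g, h). g \<in> carrier G \<and> h \<in> carrier G \<and> (\<exists>\<sigma>\<in>S. h = \<sigma> \<otimes>\<^bsub>G\<^esub> g)} \<rparr>"

text \<open>The arc \<open>(i, \<sigma>)\<close> runs from \<open>i\<close> to \<open>\<sigma> i\<close>, so distinct \<open>\<sigma>\<close> give parallel arcs, and a fixed
  point of \<open>\<sigma>\<close> gives a loop.\<close>

definition schreier_graph :: "nat \<Rightarrow> (nat \<Rightarrow> nat) set \<Rightarrow> (nat, nat \<times> (nat \<Rightarrow> nat)) pre_digraph" where
  "schreier_graph n S = \<lparr> verts = {1..n}, arcs = {1..n} \<times> S, tail = fst, head = (\<lambda>(i, \<sigma>). \<sigma> i) \<rparr>"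

section \<open>Second-largest eigenvalue and the Aldous property\<close>

text \<open>The vertices are numbered arbitrarily. Another numbering conjugates the matrix by a
  permutation matrix, so its characteristic polynomial does not depend on the choice.\<close>

definition adjacency_matrix :: "('a, 'b) pre_digraph \<Rightarrow> real mat" where
  "adjacency_matrix G = (let vs = (SOME vs. distinct vs \<and> set vs = verts G) in
     mat (length vs) (length vs)
       (\<lambda>(i, j). real (card {e \<in> arcs G. tail G e = vs ! i \<and> head G e = vs ! j})))"

text \<open>Eigenvalues are counted with multiplicity. The adjacency matrix of a symmetric graph is
  real symmetric, so that all of its eigenvalues are real.\<close>

definition adjacency_eigenvalues :: "('a, 'b) pre_digraph \<Rightarrow> real multiset" where
  "adjacency_eigenvalues G = proots (char_poly (adjacency_matrix G))"

definition second_largest_eigenvalue :: "('a, 'b) pre_digraph \<Rightarrow> real" where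
  "second_largest_eigenvalue G =
     (let E = adjacency_eigenvalues G in Max_mset (E - {#Max_mset E#}))"

definition aldous_property :: "nat \<Rightarrow> (nat \<Rightarrow> nat) set \<Rightarrow> bool" where
  "aldous_property n S \<longleftrightarrow>
     second_largest_eigenvalue (with_proj (cayley_graph (sym_group n) S)) =
     second_largest_eigenvalue (schreier_graph n S)"

end

theory Submission
  imports Defs "HOL-Analysis.Function_Topology"
begin

text \<open>
  Both graphs are regular of degree \<open>|R\<^sub>n(2)|\<close>, so it suffices to compare the spectral gaps of their
  Laplacians. An eigenfunction \<open>f\<close> of the Schreier graph lifts to \<open>g \<mapsto> f (g 1)\<close>. Conversely, let \<open>F\<close>
  be a lowest centred eigenfunction of the Cayley graph. Its fibre sums \<open>j \<mapsto> \<Sum>{F g | g i = j}\<close> are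
  eigenfunctions of the Schreier graph for the same eigenvalue. If they all vanish, then \<open>F\<close> is
  centred on every coset \<open>S\<^sub>n\<^sub>-\<^sub>1 g\<close>, and keeping only the generators \<open>R\<^sub>n\<^sub>-\<^sub>1(2)\<close> bounds its energy from
  below by the gap of the Cayley graph of \<open>S\<^sub>n\<^sub>-\<^sub>1\<close>, which by induction is that of the Schreier graph on
  \<open>n - 1\<close> points. For \<open>n = 4\<close> the two copies of \<open>S\<^sub>3\<close> on \<open>{1, 2, 3}\<close> and \<open>{2, 3, 4}\<close> contribute \<open>2\<close> each,
  which matches the gap \<open>4\<close>.

  It remains to see that the gap of the Schreier graph does not increase with \<open>n\<close>. Half its energy is
  \<open>(n - 2) \<Sum>(f i - f (i + 1))\<^sup>2 + 2 \<Sum>(f i - f (i + 2))\<^sup>2\<close>, and stretching the lowest eigenfunction on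
  \<open>n - 1\<close> points by linear interpolation gives a good enough test function on \<open>n\<close> points.
\<close>

section \<open>Spectral gaps of weighted graphs\<close>

text \<open>The sum runs over ordered pairs, so every edge counts twice. This is the source of the
  factors 2 in \<open>spectral_gap\<close> and in the summation by parts.\<close>

definition energy :: "'a set \<Rightarrow> ('a \<Rightarrow> 'a \<Rightarrow> real) \<Rightarrow> ('a \<Rightarrow> real) \<Rightarrow> real" where
  "energy S a f = (\<Sum>x\<in>S. \<Sum>y\<in>S. a x y * (f x - f y)\<^sup>2)"

definition laplacian :: "'a set \<Rightarrow> ('a \<Rightarrow> 'a \<Rightarrow> real) \<Rightarrow> ('a \<Rightarrow> real) \<Rightarrow> 'a \<Rightarrow> real" where
  "laplacian S a f x = (\<Sum>y\<in>S. a x y * (f x - f y))"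

definition centred_eigenfunction ::
  "'a set \<Rightarrow> ('a \<Rightarrow> 'a \<Rightarrow> real) \<Rightarrow> real \<Rightarrow> ('a \<Rightarrow> real) \<Rightarrow> bool" where
  "centred_eigenfunction S a \<gamma> f \<longleftrightarrow>
     (\<exists>x\<in>S. f x \<noteq> 0) \<and> sum f S = 0 \<and> (\<forall>x\<in>S. laplacian S a f x = \<gamma> * f x)"

text \<open>For symmetric weights, \<gamma> is the least Laplacian eigenvalue on functions of sum
  zero. As a predicate it offers both halves that the comparisons use: an eigenfunction to transport
  to another graph, and the Rayleigh bound for arbitrary test functions.\<close>

definition spectral_gap :: "'a set \<Rightarrow> ('a \<Rightarrow> 'a \<Rightarrow> real) \<Rightarrow> real \<Rightarrow> bool" where
  "spectral_gap S a \<gamma> \<longleftrightarrow> (\<exists>f. centred_eigenfunction S a \<gamma> f) \<and>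
     (\<forall>f. sum f S = 0 \<longrightarrow> 2 * \<gamma> * (\<Sum>x\<in>S. (f x)\<^sup>2) \<le> energy S a f)"

text \<open>Summation by parts: exchanging the names of the two summation variables gives a second
  form of the same sum, and adding both forms produces the product of differences.\<close>

lemma sum_laplacian_mult:
  assumes sym: "\<And>x y. x \<in> S \<Longrightarrow> y \<in> S \<Longrightarrow> a x y = a y x"
  shows "2 * (\<Sum>x\<in>S. laplacian S a f x * h x) =
    (\<Sum>x\<in>S. \<Sum>y\<in>S. a x y * (f x - f y) * (h x - h y))"
proof -
  have "(\<Sum>x\<in>S. laplacian S a f x * h x) = (\<Sum>x\<in>S. \<Sum>y\<in>S. a x y * (f x - f y) * h x)"
    by (simp add: laplacian_def sum_distrib_right)
  moreover have "\<dots> = (\<Sum>x\<in>S. \<Sum>y\<in>S. a x y * (f y - f x) * h y)"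
    by (subst sum.swap) (intro sum.cong refl, simp add: sym)
  moreover have "(\<Sum>x\<in>S. \<Sum>y\<in>S. a x y * (f x - f y) * h x) +
      (\<Sum>x\<in>S. \<Sum>y\<in>S. a x y * (f y - f x) * h y) =
    (\<Sum>x\<in>S. \<Sum>y\<in>S. a x y * (f x - f y) * (h x - h y))"
    by (simp add: sum.distrib[symmetric] algebra_simps)
  ultimately show ?thesis by linarith
qed

lemma energy_eigenfunction:
  assumes sym: "\<And>x y. x \<in> S \<Longrightarrow> y \<in> S \<Longrightarrow> a x y = a y x"
    and "centred_eigenfunction S a \<gamma> f"
  shows "energy S a f = 2 * \<gamma> * (\<Sum>x\<in>S. (f x)\<^sup>2)"
proof -
  have "(\<Sum>x\<in>S. laplacian S a f x * f x) = \<gamma> * (\<Sum>x\<in>S. (f x)\<^sup>2)"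
    using assms(2) by (simp add: centred_eigenfunction_def sum_distrib_left power2_eq_square mult.assoc)
  with sum_laplacian_mult[where S = S and a = a and f = f and h = f, OF sym] show ?thesis
    by (simp add: energy_def power2_eq_square mult.assoc)
qed

lemma sum_square_pos:
  fixes f :: "'a \<Rightarrow> real"
  assumes "finite S" "x \<in> S" "f x \<noteq> 0"
  shows "0 < (\<Sum>x\<in>S. (f x)\<^sup>2)"
  using assms by (intro sum_pos2[where i = x]) auto

lemma eigenfunction_norm_pos:
  assumes "finite S" and "centred_eigenfunction S a \<gamma> f"
  shows "0 < (\<Sum>x\<in>S. (f x)\<^sup>2)"
  using assms by (auto simp: centred_eigenfunction_def intro: sum_square_pos)

lemma eigenvalue_ge_gap:
  assumes fin: "finite S" and sym: "\<And>x y. x \<in> S \<Longrightarrow> y \<in> S \<Longrightarrow> a x y = a y x"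
    and gap: "spectral_gap S a \<gamma>" and f: "centred_eigenfunction S a \<delta> f"
  shows "\<gamma> \<le> \<delta>"
proof -
  have "2 * \<gamma> * (\<Sum>x\<in>S. (f x)\<^sup>2) \<le> 2 * \<delta> * (\<Sum>x\<in>S. (f x)\<^sup>2)"
    using gap f energy_eigenfunction[OF sym f]
    by (auto simp: spectral_gap_def centred_eigenfunction_def)
  moreover have "0 < (\<Sum>x\<in>S. (f x)\<^sup>2)"
    by (rule eigenfunction_norm_pos[OF fin f])
  ultimately show ?thesis by simp
qed

lemma spectral_gap_cong:
  assumes "\<And>x y. x \<in> S \<Longrightarrow> y \<in> S \<Longrightarrow> a x y = b x y"
  shows "spectral_gap S a \<gamma> \<longleftrightarrow> spectral_gap S b \<gamma>"
proof -
  have "energy S a f = energy S b f" "x \<in> S \<Longrightarrow> laplacian S a f x = laplacian S b f x" for f x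
    using assms by (auto simp: energy_def laplacian_def intro!: sum.cong)
  then show ?thesis by (simp add: spectral_gap_def centred_eigenfunction_def)
qed

lemma energy_scale: "energy S a (\<lambda>x. c * f x) = c\<^sup>2 * energy S a f"
  by (simp add: energy_def sum_distrib_left right_diff_distrib[symmetric] power_mult_distrib
      mult.left_commute)

section \<open>Existence of the spectral gap by minimising the energy\<close>

text \<open>Requiring the value 0 outside \<open>S\<close> places the functions in a product of
  compact intervals and points, which is compact by Tychonoff; the two equations cut out closed
  subsets of it.\<close>

lemma compact_unit_sphere_centred:
  fixes S :: "'a set"
  assumes fin: "finite S"
  shows "compact {f :: 'a \<Rightarrow> real. (\<forall>x. x \<notin> S \<longrightarrow> f x = 0) \<and> sum f S = 0 \<and> (\<Sum>x\<in>S. (f x)\<^sup>2) = 1}"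
    (is "compact ?K")
proof -
  define B where "B = PiE UNIV (\<lambda>x. if x \<in> S then {-1..1::real} else {0})"
  have "compactin (product_topology (\<lambda>x. euclidean) UNIV) B"
    unfolding B_def compactin_PiE by auto
  then have B: "compact B"
    by (simp add: euclidean_product_topology)
  have "closed {f :: 'a \<Rightarrow> real. sum f S = 0}" "closed {f :: 'a \<Rightarrow> real. (\<Sum>x\<in>S. (f x)\<^sup>2) = 1}"
    by (intro closed_Collect_eq continuous_intros continuous_on_product_coordinates)+
  with B have "compact (B \<inter> {f. sum f S = 0} \<inter> {f. (\<Sum>x\<in>S. (f x)\<^sup>2) = 1})"
    by (intro compact_Int_closed)
  moreover have "?K = B \<inter> {f. sum f S = 0} \<inter> {f. (\<Sum>x\<in>S. (f x)\<^sup>2) = 1}"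
  proof -
    have "\<bar>f x\<bar> \<le> 1" if "(\<Sum>x\<in>S. (f x)\<^sup>2) = 1" "x \<in> S" for f :: "'a \<Rightarrow> real" and x
      using member_le_sum[of x S "\<lambda>x. (f x)\<^sup>2"] that fin abs_square_le_1 by auto
    then show ?thesis
      by (fastforce simp: B_def PiE_iff abs_le_iff split: if_splits)
  qed
  ultimately show ?thesis by simp
qed

text \<open>The energy attains its minimum on the unit sphere of centred functions, and the first
  variation at the minimiser is the eigenvalue equation. The two distinct points provide a nonzero
  centred function, so that the sphere is not empty.\<close>

lemma spectral_gap_exists:
  fixes a :: "'a \<Rightarrow> 'a \<Rightarrow> real"
  assumes fin: "finite S" and uv: "u \<in> S" "v \<in> S" "u \<noteq> v"
    and sym: "\<And>x y. x \<in> S \<Longrightarrow> y \<in> S \<Longrightarrow> a x y = a y x"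
  shows "\<exists>\<gamma>. spectral_gap S a \<gamma>"
proof -
  define K where "K = {f :: 'a \<Rightarrow> real. (\<forall>x. x \<notin> S \<longrightarrow> f x = 0) \<and> sum f S = 0 \<and> (\<Sum>x\<in>S. (f x)\<^sup>2) = 1}"
  define N where "N f = (\<Sum>x\<in>S. (f x)\<^sup>2)" for f :: "'a \<Rightarrow> real"
  have cong: "energy S a f = energy S a g" if "\<And>x. x \<in> S \<Longrightarrow> f x = g x" for f g
    using that by (simp add: energy_def)
  have normalise: "(\<lambda>x. if x \<in> S then f x / sqrt (N f) else 0) \<in> K" (is "?g \<in> K")
    if "sum f S = 0" "N f > 0" for f
  proof -
    have "sum ?g S = 0" using that by (simp add: sum_divide_distrib[symmetric])
    moreover have "(\<Sum>x\<in>S. (?g x)\<^sup>2) = N f / (sqrt (N f))\<^sup>2"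
      by (simp add: power_divide sum_divide_distrib[symmetric] N_def)
    ultimately show ?thesis using that by (simp add: K_def)
  qed
  have "K \<noteq> {}"
  proof -
    let ?f = "\<lambda>x. if x = u then 1 else if x = v then - 1 else 0 :: real"
    have "sum ?f S = (\<Sum>x\<in>S. (if x = u then 1 else 0) + (if x = v then -1 else 0))"
      using uv by (intro sum.cong) auto
    then have "sum ?f S = 0" using uv fin by (simp add: sum.distrib)
    moreover have "N ?f > 0" unfolding N_def using uv fin by (intro sum_square_pos[of _ u]) auto
    ultimately show ?thesis using normalise by blast
  qed
  moreover have "compact K" unfolding K_def by (rule compact_unit_sphere_centred[OF fin])
  moreover have "continuous_on K (energy S a)"
    unfolding energy_def
    by (intro continuous_intros continuous_on_subset[OF continuous_on_product_coordinates]) auto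
  ultimately obtain f where f: "f \<in> K" and min: "\<And>h. h \<in> K \<Longrightarrow> energy S a f \<le> energy S a h"
    using continuous_attains_inf by metis
  define \<gamma> where "\<gamma> = energy S a f / 2"
  have gap: "2 * \<gamma> * N h \<le> energy S a h" if "sum h S = 0" for h
  proof (cases "N h > 0")
    case True
    from min[OF normalise[OF that True]]
    have "2 * \<gamma> \<le> energy S a (\<lambda>x. (1 / sqrt (N h)) * h x)"
      unfolding \<gamma>_def by (subst (asm) cong[of _ "\<lambda>x. (1 / sqrt (N h)) * h x"]) auto
    then show ?thesis using True by (subst (asm) energy_scale) (simp add: field_simps)
  next
    case False
    then have "\<forall>x\<in>S. h x = 0" using sum_square_pos[OF fin] unfolding N_def by blast
    then show ?thesis by (simp add: N_def energy_def)
  qed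
  have f0: "sum f S = 0" and Nf: "N f = 1" using f by (auto simp: K_def N_def)
  \<comment> \<open>The residual of the eigenvalue equation. It is shown to be orthogonal to every
    centred function; being centred itself, it then vanishes.\<close>
  define r where "r x = laplacian S a f x - \<gamma> * f x" for x
  have orth: "(\<Sum>x\<in>S. r x * h x) = 0" if h: "sum h S = 0" for h
  proof -
    define b where "b = (\<Sum>x\<in>S. r x * h x)"
    define c where "c = energy S a h - 2 * \<gamma> * N h"
    \<comment> \<open>The Rayleigh bound for \<open>f + t h\<close>, expanded in \<open>t\<close>.
      The constant term cancels because \<open>f\<close> attains the bound.\<close>
    have quad: "0 \<le> 4 * t * b + t\<^sup>2 * c" for t
    proof -
      have "sum (\<lambda>x. f x + t * h x) S = 0"
        using f0 h by (simp add: sum.distrib sum_distrib_left[symmetric])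
      from gap[OF this] have "2 * \<gamma> * N (\<lambda>x. f x + t * h x) \<le> energy S a (\<lambda>x. f x + t * h x)" .
      moreover have "N (\<lambda>x. f x + t * h x) = N f + 2 * t * (\<Sum>x\<in>S. f x * h x) + t\<^sup>2 * N h"
        by (simp add: N_def power2_sum sum.distrib sum_distrib_left power_mult_distrib algebra_simps)
      moreover have "energy S a (\<lambda>x. f x + t * h x) = energy S a f
          + 2 * t * (\<Sum>x\<in>S. \<Sum>y\<in>S. a x y * (f x - f y) * (h x - h y)) + t\<^sup>2 * energy S a h"
        unfolding energy_def sum_distrib_left sum.distrib[symmetric]
        by (intro sum.cong refl) (simp add: power2_eq_square algebra_simps)
      moreover have "(\<Sum>x\<in>S. \<Sum>y\<in>S. a x y * (f x - f y) * (h x - h y)) =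
          2 * (\<Sum>x\<in>S. laplacian S a f x * h x)"
        by (rule sum_laplacian_mult[OF sym, symmetric])
      moreover have "(\<Sum>x\<in>S. laplacian S a f x * h x) = b + \<gamma> * (\<Sum>x\<in>S. f x * h x)"
        by (simp add: b_def r_def algebra_simps sum_subtractf sum_distrib_left)
      moreover have "energy S a f = 2 * \<gamma>" by (simp add: \<gamma>_def)
      ultimately show ?thesis
        using Nf by (simp only:) (simp add: c_def algebra_simps)
    qed
    have "b = 0"
    proof (rule ccontr)
      assume "b \<noteq> 0"
      \<comment> \<open>A positive upper bound for \<open>c\<close>. At \<open>t = - b / k\<close>
        the quadratic is then at most \<open>- 3 b^2 / k\<close>, which is negative.\<close>
      define k where "k = \<bar>c\<bar> + 1"
      have k: "k > 0" "c \<le> k" by (auto simp: k_def)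
      have "4 * (- b / k) * b + (- b / k)\<^sup>2 * c \<le> 4 * (- b / k) * b + (- b / k)\<^sup>2 * k"
        using k by (intro add_left_mono mult_left_mono) auto
      also have "\<dots> = - 3 * b\<^sup>2 / k"
        using k by (simp add: field_simps power2_eq_square)
      also have "\<dots> < 0" using k \<open>b \<noteq> 0\<close> by (simp add: field_simps)
      finally show False using quad[of "- b / k"] by linarith
    qed
    then show ?thesis by (simp add: b_def)
  qed
  have "sum r S = 0"
    using sum_laplacian_mult[where S = S and a = a and f = f and h = "\<lambda>_. 1", OF sym] f0
    by (simp add: r_def sum_subtractf sum_distrib_left[symmetric])
  then have "(\<Sum>x\<in>S. r x * r x) = 0" by (rule orth)
  then have "\<forall>x\<in>S. r x = 0" using fin by (simp add: sum_nonneg_eq_0_iff)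
  moreover have "\<exists>x\<in>S. f x \<noteq> 0" using Nf by (auto simp: N_def intro: ccontr)
  ultimately have "centred_eigenfunction S a \<gamma> f"
    using f0 by (simp add: centred_eigenfunction_def r_def)
  with gap show ?thesis by (auto simp: spectral_gap_def N_def)
qed

section \<open>From the spectral gap to the second-largest adjacency eigenvalue\<close>

text \<open>The second factor is the characteristic polynomial of the map that \<open>A\<close> induces modulo constant
  vectors, so it sees exactly the eigenvalues of \<open>A\<close> on centred vectors when \<open>A\<close> is symmetric.\<close>

lemma char_poly_const_row_sums:
  fixes A :: "'a :: field mat"
  assumes A: "A \<in> carrier_mat (Suc m) (Suc m)"
    and row: "\<And>i. i < Suc m \<Longrightarrow> (\<Sum>j<Suc m. A $$ (i, j)) = d"
  shows "char_poly A = [:- d, 1:] * char_poly (mat m m (\<lambda>(i, j). A $$ (Suc i, Suc j) - A $$ (0, Suc j)))"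
proof -
  define B where "B = mat m m (\<lambda>(i, j). A $$ (Suc i, Suc j) - A $$ (0, Suc j))"
  define D where "D = mat 1 1 (\<lambda>_. d)"
  define C where "C = four_block_mat D (mat 1 m (\<lambda>(i, j). A $$ (0, Suc j))) (0\<^sub>m m 1) B"
  \<comment> \<open>The columns of \<open>P\<close> are the all-ones vector, an eigenvector of
    \<open>A\<close> for \<open>d\<close>, followed by the standard basis vectors other than the
    first; \<open>Q\<close> is its inverse. In this basis \<open>A\<close> becomes the block
    triangular matrix \<open>C\<close>.\<close>
  define P :: "'a mat" where "P = mat (Suc m) (Suc m) (\<lambda>(i, j). if j = 0 \<or> i = j then 1 else 0)"
  define Q :: "'a mat" where
    "Q = mat (Suc m) (Suc m) (\<lambda>(i, j). if i = j then 1 else if j = 0 then - 1 else 0)"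
  have carr: "P \<in> carrier_mat (Suc m) (Suc m)" "Q \<in> carrier_mat (Suc m) (Suc m)"
    "C \<in> carrier_mat (Suc m) (Suc m)" "B \<in> carrier_mat m m" "D \<in> carrier_mat 1 1"
    by (auto simp: P_def Q_def C_def B_def D_def)
  have P_mult: "P * X = mat (Suc m) (Suc m) (\<lambda>(i, j). if i = 0 then X $$ (0, j) else X $$ (0, j) + X $$ (i, j))"
    if X: "X \<in> carrier_mat (Suc m) (Suc m)" for X
  proof (rule eq_matI)
    fix i j assume "i < dim_row (mat (Suc m) (Suc m) (\<lambda>(i, j). if i = 0 then X $$ (0, j) else X $$ (0, j) + X $$ (i, j)))"
      "j < dim_col (mat (Suc m) (Suc m) (\<lambda>(i, j). if i = 0 then X $$ (0, j) else X $$ (0, j) + X $$ (i, j)))"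
    then have ij: "i < Suc m" "j < Suc m" by auto
    have "(P * X) $$ (i, j) = (\<Sum>k<Suc m. (if k = 0 \<or> i = k then 1 else 0) * X $$ (k, j))"
      using ij X by (auto simp: P_def times_mat_def scalar_prod_def lessThan_atLeast0 intro!: sum.cong)
    also have "\<dots> = X $$ (0, j) + (\<Sum>k<m. if i = Suc k then X $$ (i, j) else 0)"
      by (subst sum.lessThan_Suc_shift) (auto intro!: sum.cong)
    also have "(\<Sum>k<m. if i = Suc k then X $$ (i, j) else 0) = (if i = 0 then 0 else X $$ (i, j))"
      using ij by (cases i) auto
    finally show "(P * X) $$ (i, j) = mat (Suc m) (Suc m) (\<lambda>(i, j). if i = 0 then X $$ (0, j) else X $$ (0, j) + X $$ (i, j)) $$ (i, j)"
      using ij by auto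
  qed (use X carr in auto)
  have PQ: "P * Q = 1\<^sub>m (Suc m)"
    by (subst P_mult[OF carr(2)]) (rule eq_matI, auto simp: Q_def)
  have QP: "Q * P = 1\<^sub>m (Suc m)"
    by (rule mat_mult_left_right_inverse[OF carr(1,2) PQ])
  have AP: "A * P = P * C"
  proof (rule eq_matI)
    fix i j assume "i < dim_row (P * C)" "j < dim_col (P * C)"
    then have ij: "i < Suc m" "j < Suc m" using carr by auto
    have "(A * P) $$ (i, j) = (\<Sum>k<Suc m. A $$ (i, k) * (if j = 0 \<or> k = j then 1 else 0))"
      using ij A by (auto simp: P_def times_mat_def scalar_prod_def lessThan_atLeast0 intro!: sum.cong)
    also have "\<dots> = (if j = 0 then d else A $$ (i, j))"
    proof (cases "j = 0")
      case False
      have "(\<Sum>k<Suc m. A $$ (i, k) * (if j = 0 \<or> k = j then 1 else 0)) =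
          (\<Sum>k<Suc m. if k = j then A $$ (i, k) else 0)"
        using False by (intro sum.cong) auto
      then show ?thesis using ij False by simp
    qed (use row[OF ij(1)] in simp)
    finally show "(A * P) $$ (i, j) = (P * C) $$ (i, j)"
      using ij by (subst P_mult[OF carr(3)]) (auto simp: C_def B_def D_def)
  qed (use carr A in auto)
  have "A = A * (P * Q)" using A by (simp add: PQ)
  also have "\<dots> = A * P * Q" by (rule assoc_mult_mat[symmetric, OF A carr(1,2)])
  finally have "A = P * C * Q" unfolding AP .
  then have "similar_mat A C"
    using A carr PQ QP by (intro similar_matI[of _ _ P Q "Suc m"]) blast+
  then have "char_poly A = char_poly C" by (rule char_poly_similar)
  also have "\<dots> = char_poly D * char_poly B"
    unfolding C_def using carr by (intro char_poly_four_block_zeros_col) auto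
  also have "char_poly D = [:- d, 1:]"
    by (simp add: char_poly_def char_poly_matrix_def D_def det_single)
  finally show ?thesis by (simp add: B_def)
qed

text \<open>Since the graph is regular, an adjacency eigenvalue is \<open>d\<close> minus a
  Laplacian eigenvalue. One eigenvalue \<open>d\<close> is split off by
  \<open>char_poly_const_row_sums\<close>; the gap bounds every other real root by
  \<open>d - \<gamma>\<close>, and its eigenfunction shows that this value is a root.\<close>

lemma second_largest_eigenvalue_eq:
  fixes G :: "('a, 'b) pre_digraph"
  defines "a \<equiv> \<lambda>x y. real (card {e \<in> arcs G. tail G e = x \<and> head G e = y})"
  assumes fin: "finite (verts G)"
    and sym: "\<And>x y. x \<in> verts G \<Longrightarrow> y \<in> verts G \<Longrightarrow> a x y = a y x"
    and row: "\<And>x. x \<in> verts G \<Longrightarrow> (\<Sum>y\<in>verts G. a x y) = d"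
    and gap: "spectral_gap (verts G) a \<gamma>"
  shows "second_largest_eigenvalue G = d - \<gamma>"
proof -
  define S where "S = verts G"
  obtain f where f: "centred_eigenfunction S a \<gamma> f" using gap by (auto simp: spectral_gap_def S_def)
  define vs where "vs = (SOME vs. distinct vs \<and> set vs = verts G)"
  have vs: "distinct vs" "set vs = S"
    using someI_ex[of "\<lambda>vs. distinct vs \<and> set vs = verts G", folded vs_def] finite_distinct_list[OF fin] unfolding S_def by blast+
  obtain m where m: "length vs = Suc m"
    using f vs by (cases vs) (auto simp: centred_eigenfunction_def)
  have sum_S: "sum h S = (\<Sum>j<Suc m. h (vs ! j))" for h :: "'a \<Rightarrow> real"
    using sum.reindex_bij_betw[OF bij_betw_nth[OF vs(1) refl refl], of h] vs m by simp
  have vsS: "vs ! i \<in> S" if "i < Suc m" for i using that m vs by (metis nth_mem)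
  define A where "A = mat (Suc m) (Suc m) (\<lambda>(i, j). a (vs ! i) (vs ! j))"
  define B where "B = mat m m (\<lambda>(i, j). A $$ (Suc i, Suc j) - A $$ (0, Suc j))"
  have A: "A = adjacency_matrix G"
    by (simp add: adjacency_matrix_def A_def a_def vs_def[symmetric] m Let_def)
  have cA: "A \<in> carrier_mat (Suc m) (Suc m)" and cB: "B \<in> carrier_mat m m"
    by (auto simp: A_def B_def)
  have "char_poly A = [:- d, 1:] * char_poly B"
    unfolding B_def using row vsS
    by (intro char_poly_const_row_sums) (auto simp: A_def sum_S[symmetric] S_def simp del: sum.lessThan_Suc)
  moreover have "char_poly B \<noteq> 0"
    using degree_monic_char_poly[OF cB] by auto
  ultimately have E: "adjacency_eigenvalues G = add_mset d (proots (char_poly B))"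
    by (simp add: adjacency_eigenvalues_def A[symmetric] proots_mult del: mult_pCons_left)
  have lap: "laplacian S a h (vs ! i) = d * h (vs ! i) - (\<Sum>j<Suc m. a (vs ! i) (vs ! j) * h (vs ! j))"
    if "i < Suc m" for h i
    using row[of "vs ! i"] vsS[OF that] sum_S[of "\<lambda>y. a (vs ! i) y * h y"]
    by (simp add: laplacian_def S_def[symmetric] right_diff_distrib sum_subtractf
        sum_distrib_right[symmetric] del: sum.lessThan_Suc)
  have B_mult: "(B *\<^sub>v v) $ i = (\<Sum>j<m. (a (vs ! Suc i) (vs ! Suc j) - a (vs ! 0) (vs ! Suc j)) * v $ j)"
    if "i < m" "v \<in> carrier_vec m" for v i
    using that by (auto simp: B_def A_def mult_mat_vec_def scalar_prod_def lessThan_atLeast0 intro!: sum.cong)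
  have upper: "k \<le> d - \<gamma>" if "poly (char_poly B) k = 0" for k
  proof -
    from that obtain v where v: "v \<in> carrier_vec m" "v \<noteq> 0\<^sub>v m" "B *\<^sub>v v = k \<cdot>\<^sub>v v"
      using eigenvalue_root_char_poly[OF cB] cB by (auto simp: eigenvalue_def eigenvector_def)
    define w where "w i = (case i of 0 \<Rightarrow> 0 | Suc i \<Rightarrow> v $ i)" for i
    define idx where "idx = inv_into {..<Suc m} ((!) vs)"
    have idx: "idx (vs ! i) = i" if "i < Suc m" for i
      using that vs m unfolding idx_def by (intro inv_into_f_f) (auto simp: inj_on_def nth_eq_iff_index_eq)
    define c where "c = (\<Sum>j<Suc m. a (vs ! 0) (vs ! j) * w j)"
    have w: "(\<Sum>j<Suc m. a (vs ! i) (vs ! j) * w j) = k * w i + c" if "i < Suc m" for i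
    proof (cases i)
      case (Suc i')
      then have "i' < m" using that by simp
      have "(\<Sum>j<Suc m. a (vs ! i) (vs ! j) * w j) - c = (B *\<^sub>v v) $ i'"
        unfolding B_mult[OF \<open>i' < m\<close> v(1)] c_def sum.lessThan_Suc_shift Suc
        by (simp add: w_def left_diff_distrib sum_subtractf)
      also have "\<dots> = k * w i" using v \<open>i' < m\<close> Suc by (simp add: w_def)
      finally show ?thesis by simp
    qed (simp add: c_def w_def)
    define \<mu> where "\<mu> = (\<Sum>j<Suc m. w j) / real (Suc m)"
    define g where "g x = w (idx x) - \<mu>" for x
    have g: "g (vs ! i) = w i - \<mu>" if "i < Suc m" for i using idx[OF that] by (simp add: g_def)
    have "sum g S = (\<Sum>j<Suc m. w j - \<mu>)" unfolding sum_S using g by (intro sum.cong) auto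
    then have g_sum: "sum g S = 0" by (simp add: sum_subtractf \<mu>_def del: sum.lessThan_Suc of_nat_Suc)
    define c' where "c' = (d - k) * \<mu> - c"
    have lap_g: "laplacian S a g x = (d - k) * g x + c'" if "x \<in> S" for x
    proof -
      obtain i where i: "i < Suc m" "x = vs ! i" using \<open>x \<in> S\<close> vs m by (metis in_set_conv_nth)
      have "laplacian S a g x = laplacian S a (\<lambda>x. w (idx x)) x"
        by (simp add: laplacian_def g_def)
      also have "\<dots> = d * w i - (\<Sum>j<Suc m. a (vs ! i) (vs ! j) * w j)"
        unfolding i(2) lap[OF i(1)] using idx i(1) by (simp del: sum.lessThan_Suc)
      also have "\<dots> = (d - k) * g x + c'"
        unfolding w[OF i(1)] i(2) g[OF i(1)] c'_def by (simp add: algebra_simps)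
      finally show ?thesis .
    qed
    \<comment> \<open>Tested against the constant 1, a Laplacian has sum zero. As \<open>g\<close>
      is centred too, the leftover constant \<open>c'\<close> must vanish.\<close>
    have "(\<Sum>x\<in>S. laplacian S a g x) = 0"
      using sum_laplacian_mult[where S = S and a = a and f = g and h = "\<lambda>_. 1"] sym
      by (simp add: S_def)
    moreover have "(\<Sum>x\<in>S. laplacian S a g x) = real (card S) * c'"
      using g_sum by (simp add: lap_g sum.distrib sum_distrib_left[symmetric])
    moreover have "card S = Suc m" using vs m distinct_card by fastforce
    ultimately have "c' = 0" by simp
    moreover have "\<exists>x\<in>S. g x \<noteq> 0"
    proof (rule ccontr)
      assume "\<not> ?thesis"
      then have "w i = \<mu>" if "i < Suc m" for i using g[OF that] vsS[OF that] by auto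
      then have "w i = 0" if "i < Suc m" for i using that by (metis w_def nat.case(1) zero_less_Suc)
      from this[of "Suc _"] have "v = 0\<^sub>v m" using v(1) by (intro eq_vecI) (auto simp: w_def)
      with v(2) show False ..
    qed
    ultimately have "centred_eigenfunction S a (d - k) g"
      using g_sum lap_g by (simp add: centred_eigenfunction_def)
    then show ?thesis
      using eigenvalue_ge_gap[OF fin sym gap, of "d - k" g] by (simp add: S_def)
  qed
  have root: "poly (char_poly B) (d - \<gamma>) = 0"
  proof -
    \<comment> \<open>The class of \<open>f\<close> modulo constants, in the coordinates used for
      \<open>B\<close>. It is nonzero because a constant function of sum zero vanishes.\<close>
    define v where "v = vec m (\<lambda>i. f (vs ! Suc i) - f (vs ! 0))"
    have v: "v \<in> carrier_vec m" by (simp add: v_def)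
    have af: "(\<Sum>j<Suc m. a (vs ! i) (vs ! j) * (f (vs ! j) - c)) = (d - \<gamma>) * f (vs ! i) - d * c"
      if "i < Suc m" for i c
    proof -
      have "laplacian S a f (vs ! i) = \<gamma> * f (vs ! i)"
        using f vsS[OF that] by (simp add: centred_eigenfunction_def)
      moreover have "(\<Sum>j<Suc m. a (vs ! i) (vs ! j)) = d"
        using row[of "vs ! i"] vsS[OF that] by (simp add: S_def[symmetric] sum_S del: sum.lessThan_Suc)
      ultimately show ?thesis
        using lap[OF that, of f]
        by (simp add: right_diff_distrib left_diff_distrib sum_subtractf sum_distrib_right[symmetric]
            del: sum.lessThan_Suc)
    qed
    have "B *\<^sub>v v = (d - \<gamma>) \<cdot>\<^sub>v v"
    proof (rule eq_vecI)
      fix i assume "i < dim_vec ((d - \<gamma>) \<cdot>\<^sub>v v)"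
      then have i: "i < m" using v by simp
      have "(B *\<^sub>v v) $ i = (\<Sum>j<Suc m. a (vs ! Suc i) (vs ! j) * (f (vs ! j) - f (vs ! 0)))
         - (\<Sum>j<Suc m. a (vs ! 0) (vs ! j) * (f (vs ! j) - f (vs ! 0)))"
        unfolding B_mult[OF i v] sum.lessThan_Suc_shift
        by (simp add: v_def left_diff_distrib sum_subtractf)
      also have "\<dots> = (d - \<gamma>) * (f (vs ! Suc i) - f (vs ! 0))"
        using i by (subst (1 2) af) (auto simp: algebra_simps)
      finally show "(B *\<^sub>v v) $ i = ((d - \<gamma>) \<cdot>\<^sub>v v) $ i" using i by (simp add: v_def)
    qed (simp add: B_def v_def)
    moreover have "v \<noteq> 0\<^sub>v m"
    proof
      assume "v = 0\<^sub>v m"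
      then have "f (vs ! Suc i) = f (vs ! 0)" if "i < m" for i
        using that by (auto simp: v_def vec_eq_iff)
      then have const: "f (vs ! i) = f (vs ! 0)" if "i < Suc m" for i using that by (cases i) auto
      have "sum f S = (\<Sum>j<Suc m. f (vs ! 0))"
        unfolding sum_S by (intro sum.cong refl const) simp
      also have "\<dots> = real (Suc m) * f (vs ! 0)" by (simp del: sum.lessThan_Suc of_nat_Suc)
      finally have "f (vs ! 0) = 0" using f by (simp add: centred_eigenfunction_def)
      then have "f x = 0" if "x \<in> S" for x
        using const that vs m by (metis in_set_conv_nth)
      then show False using f by (auto simp: centred_eigenfunction_def)
    qed
    ultimately have "eigenvalue B (d - \<gamma>)"
      using cB v by (auto simp: eigenvalue_def eigenvector_def)
    then show ?thesis using eigenvalue_root_char_poly[OF cB] by simp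
  qed
  \<comment> \<open>This makes \<open>d\<close> the maximum of the multiset, so that the one copy
    removed in \<open>second_largest_eigenvalue\<close> is the eigenvalue of the constants.\<close>
  have "\<gamma> \<ge> 0"
  proof -
    have "0 \<le> energy S a f" by (auto simp: energy_def a_def intro!: sum_nonneg)
    moreover have "energy S a f = 2 * \<gamma> * (\<Sum>x\<in>S. (f x)\<^sup>2)"
      using energy_eigenfunction[OF _ f] sym by (simp add: S_def)
    moreover have "0 < (\<Sum>x\<in>S. (f x)\<^sup>2)"
      using f fin by (auto simp: centred_eigenfunction_def S_def intro: sum_square_pos)
    ultimately show ?thesis by (simp add: zero_le_mult_iff)
  qed
  then have "Max_mset (add_mset d (proots (char_poly B))) = d"
    using upper \<open>char_poly B \<noteq> 0\<close> by (intro Max_eqI) (fastforce simp: poly_roots_finite)+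
  moreover have "Max_mset (proots (char_poly B)) = d - \<gamma>"
    using upper root \<open>char_poly B \<noteq> 0\<close> by (intro Max_eqI) (auto simp: poly_roots_finite)
  ultimately show ?thesis
    by (simp add: second_largest_eigenvalue_def E Let_def)
qed

section \<open>Permutations by their invariant initial segments\<close>

text \<open>The bound \<open>n\<close> does not enter: for a permutation of \<open>{1..n}\<close>,
  neither 0 nor any index from \<open>n\<close> on is a break. Thus a permutation keeps its breaks
  when it is regarded as acting on more points.\<close>

definition breaks :: "(nat \<Rightarrow> nat) \<Rightarrow> nat set" where
  "breaks \<sigma> = {i. \<sigma> ` {1..i} \<noteq> {1..i}}"

lemma breaks_subset:
  assumes "\<sigma> permutes {1..n}"
  shows "breaks \<sigma> \<subseteq> {1..<n}"
proof
  fix i assume i: "i \<in> breaks \<sigma>"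
  have "\<not> n \<le> i"
  proof
    assume "n \<le> i"
    then have "\<sigma> permutes {1..i}" using permutes_subset[OF assms, of "{1..i}"] by auto
    then show False using i permutes_image by (auto simp: breaks_def)
  qed
  moreover have "i \<noteq> 0" using i by (auto simp: breaks_def intro: ccontr)
  ultimately show "i \<in> {1..<n}" by simp
qed

lemma not_break_le_iff:
  assumes \<sigma>: "\<sigma> permutes {1..n}" and c: "c \<notin> breaks \<sigma>" and x: "x \<in> {1..n}"
  shows "\<sigma> x \<le> c \<longleftrightarrow> x \<le> c"
proof -
  have "\<sigma> x \<in> \<sigma> ` {1..c} \<longleftrightarrow> x \<in> {1..c}"
    by (rule inj_image_mem_iff[OF permutes_inj[OF \<sigma>]])
  moreover have "\<sigma> x \<in> {1..n}" using x permutes_in_image[OF \<sigma>] by blast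
  ultimately show ?thesis using x c by (auto simp: breaks_def)
qed

lemma not_breakI:
  assumes "\<sigma> permutes {1..n}" and "\<And>x. x \<in> {1..c} \<Longrightarrow> \<sigma> x \<in> {1..c}"
  shows "c \<notin> breaks \<sigma>"
proof -
  have "\<sigma> ` {1..c} = {1..c}"
    by (rule endo_inj_surj[OF _ _ permutes_inj_on[OF assms(1)]]) (use assms(2) in blast)+
  then show ?thesis by (simp add: breaks_def)
qed

text \<open>Block maxima are distinct and none is a break. Indeed, a block that contains a point up
  to \<open>Max I\<close> and also reaches beyond \<open>Max I\<close> is an interval containing
  \<open>Max I\<close>, hence would be \<open>I\<close> itself.\<close>

lemma reducible_le:
  assumes \<sigma>: "\<sigma> permutes {1..n}" and "reducible n m \<sigma>"
  shows "m \<le> card ({1..n} - breaks \<sigma>)"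
proof -
  obtain P where P: "partition_on {1..n} P" "card P = m"
    and blocks: "\<And>I. I \<in> P \<Longrightarrow> (\<exists>a b. I = {a..b}) \<and> \<sigma> ` I = I"
    using assms(2) by (auto simp: reducible_def)
  have sub: "I \<subseteq> {1..n}" if "I \<in> P" for I using partition_onD1[OF P(1)] that by blast
  have ne: "I \<noteq> {}" if "I \<in> P" for I using partition_onD3[OF P(1)] that by blast
  have fin: "finite I" if "I \<in> P" for I by (rule finite_subset[OF sub[OF that]]) simp
  have inj: "inj_on Max P"
  proof (rule inj_onI)
    fix I J assume "I \<in> P" "J \<in> P" "Max I = Max J"
    then have "Max I \<in> I \<inter> J" using ne fin Max_in by (metis IntI)
    then show "I = J" using partition_onD2[OF P(1)] \<open>I \<in> P\<close> \<open>J \<in> P\<close>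
      by (auto simp: disjoint_def)
  qed
  have "Max I \<in> {1..n} - breaks \<sigma>" if I: "I \<in> P" for I
  proof -
    have MI: "Max I \<in> I" using I ne fin by simp
    have "\<sigma> x \<in> {1..Max I}" if x: "x \<in> {1..Max I}" for x
    proof -
      have "x \<in> {1..n}" using x MI sub[OF I] by auto
      then obtain J where J: "J \<in> P" "x \<in> J" using partition_onD1[OF P(1)] by blast
      have "Max J \<le> Max I"
      proof (rule ccontr)
        assume "\<not> Max J \<le> Max I"
        moreover obtain a b where "J = {a..b}" using blocks[OF J(1)] by blast
        ultimately have "Max I \<in> J" using J x fin[OF J(1)] Max_in[OF fin[OF J(1)] ne[OF J(1)]] by auto
        then have "I = J" using partition_onD2[OF P(1)] I J MI by (auto simp: disjoint_def)
        then show False using \<open>\<not> Max J \<le> Max I\<close> by simp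
      qed
      moreover have "\<sigma> x \<in> J" using J blocks by blast
      ultimately show ?thesis using sub[OF J(1)] Max_ge[OF fin[OF J(1)]] by fastforce
    qed
    then have "Max I \<notin> breaks \<sigma>" by (rule not_breakI[OF \<sigma>])
    then show ?thesis using MI sub[OF I] by auto
  qed
  then have "card P \<le> card ({1..n} - breaks \<sigma>)"
    by (intro card_inj_on_le[OF inj]) auto
  then show ?thesis using P(2) by simp
qed

text \<open>The non-breaks serve as right ends of the blocks: every point goes to the block of the
  first non-break at or after it. By \<open>not_break_le_iff\<close> a point and its image lie on
  the same side of every non-break, so they share a block.\<close>

lemma reducible_card_breaks:
  assumes \<sigma>: "\<sigma> permutes {1..n}"
  shows "reducible n (card ({1..n} - breaks \<sigma>)) \<sigma>"
proof -
  define C where "C = {1..n} - breaks \<sigma>"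
  have nC: "n \<in> C" if "n \<ge> 1" using that breaks_subset[OF \<sigma>] by (auto simp: C_def)
  define next_cut where "next_cut x = Min {c \<in> C. x \<le> c}" for x
  define B where "B c = {x \<in> {1..n}. next_cut x = c}" for c
  have finC: "finite C" by (simp add: C_def)
  have "next_cut x \<in> {c \<in> C. x \<le> c}" if "x \<in> {1..n}" for x
    unfolding next_cut_def using nC that finC by (intro Min_in) auto
  then have next_cut: "next_cut x \<in> C" "x \<le> next_cut x" if "x \<in> {1..n}" for x
    using that by blast+
  have next_cut_self: "next_cut c = c" if "c \<in> C" for c
    unfolding next_cut_def using that finC by (intro Min_eqI) auto
  have next_cut_mono: "next_cut x \<le> next_cut y" if "x \<le> y" "y \<in> {1..n}" for x y
    unfolding next_cut_def using that nC finC by (intro Min_antimono) auto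
  have CB: "c \<in> B c" if "c \<in> C" for c using that next_cut_self by (auto simp: B_def C_def)
  have "partition_on {1..n} (B ` C)"
    unfolding partition_on_def disjoint_def using CB next_cut by (auto simp: B_def)
  moreover have "card (B ` C) = card C"
    by (rule card_image) (metis (mono_tags, lifting) B_def CB inj_onI mem_Collect_eq)
  moreover have "(\<exists>a b. B c = {a..b}) \<and> \<sigma> ` B c = B c" if c: "c \<in> C" for c
  proof
    have "B c = {Min (B c)..Max (B c)}"
    proof
      show "B c \<subseteq> {Min (B c)..Max (B c)}" by (auto simp: B_def)
      have fin: "finite (B c)" by (simp add: B_def)
      then have mem: "Min (B c) \<in> B c" "Max (B c) \<in> B c" using CB[OF c] by (metis Min_in empty_iff, metis Max_in empty_iff)
      show "{Min (B c)..Max (B c)} \<subseteq> B c"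
      proof
        fix y assume y: "y \<in> {Min (B c)..Max (B c)}"
        then have y': "y \<in> {1..n}" using mem by (auto simp: B_def)
        have "next_cut (Min (B c)) = c" "next_cut (Max (B c)) = c" using mem by (auto simp: B_def)
        moreover have "Max (B c) \<in> {1..n}" using mem by (auto simp: B_def)
        ultimately have "next_cut y = c" using next_cut_mono y y' by (metis atLeastAtMost_iff order_antisym)
        then show "y \<in> B c" using y' by (simp add: B_def)
      qed
    qed
    then show "\<exists>a b. B c = {a..b}" by blast
    have "\<sigma> x \<in> B c" if "x \<in> B c" for x
    proof -
      have x: "x \<in> {1..n}" using that by (simp add: B_def)
      have "next_cut (\<sigma> x) = next_cut x"
        unfolding next_cut_def using not_break_le_iff[OF \<sigma> _ x] by (intro arg_cong[of _ _ Min]) (auto simp: C_def)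
      moreover have "\<sigma> x \<in> {1..n}" using x permutes_in_image[OF \<sigma>] by blast
      ultimately show ?thesis using that by (simp add: B_def)
    qed
    then show "\<sigma> ` B c = B c"
      by (intro endo_inj_surj permutes_inj_on[OF \<sigma>]) (auto simp: B_def)
  qed
  ultimately show ?thesis
    unfolding reducible_def C_def[symmetric] by (intro exI[of _ "B ` C"]) auto
qed

text \<open>The largest possible number of blocks is \<open>n\<close> minus the number of breaks;
  \<open>k \<le> n\<close> keeps \<open>n - k\<close> from truncating.\<close>

lemma mem_maximally_reducible_perms_iff:
  assumes "k \<le> n"
  shows "\<sigma> \<in> maximally_reducible_perms n k \<longleftrightarrow> \<sigma> permutes {1..n} \<and> card (breaks \<sigma>) = k"
proof -
  have "maximally_reducible n m \<sigma> \<longleftrightarrow> m = card ({1..n} - breaks \<sigma>)" if "\<sigma> permutes {1..n}" for m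
    using reducible_le[OF that] reducible_card_breaks[OF that]
    unfolding maximally_reducible_def by (metis order_antisym order_refl)
  moreover have "card ({1..n} - breaks \<sigma>) = n - card (breaks \<sigma>)" "card (breaks \<sigma>) \<le> n"
    if "\<sigma> permutes {1..n}"
    using breaks_subset[OF that] card_Diff_subset[of "breaks \<sigma>" "{1..n}"] card_mono[of "{1..n}" "breaks \<sigma>"]
      finite_subset[of "breaks \<sigma>" "{1..<n}"] by fastforce+
  ultimately show ?thesis
    using assms by (auto simp: maximally_reducible_perms_def)
qed

lemma breaks_inv:
  assumes "\<sigma> permutes S"
  shows "breaks (Hilbert_Choice.inv \<sigma>) = breaks \<sigma>"
proof -
  have "Hilbert_Choice.inv \<sigma> ` X = X \<longleftrightarrow> \<sigma> ` X = X" for X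
    using permutes_bij[OF assms] by (metis bij_is_inj bij_is_surj image_f_inv_f image_inv_f_f)
  then show ?thesis by (simp add: breaks_def)
qed

lemma between_not_breaks:
  assumes \<sigma>: "\<sigma> permutes S" and a: "a \<notin> breaks \<sigma>" and b: "b \<notin> breaks \<sigma>"
  shows "\<sigma> ` {a<..b} = {a<..b}"
proof -
  have "{a<..b} = {1..b} - {1..a}" by auto
  then show ?thesis
    using image_set_diff[OF permutes_inj[OF \<sigma>], of "{1..b}" "{1..a}"] a b by (simp add: breaks_def)
qed

lemma fixed_if_not_breaks:
  assumes "\<sigma> permutes S" and "k - 1 \<notin> breaks \<sigma>" and "k \<notin> breaks \<sigma>" and "k \<ge> 1"
  shows "\<sigma> k = k"
proof -
  have "{k - 1<..k} = {k}" using assms(4) by auto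
  then show ?thesis using between_not_breaks[OF assms(1-3)] by auto
qed

section \<open>The isomorphism with the Cayley graph\<close>

text \<open>The inverse matches left multiplication: passing from \<open>g\<close> to
  \<open>\<sigma> \<circ> g\<close> changes the \<open>i\<close>-th set exactly when
  \<open>i\<close> is a break of \<open>\<sigma>\<close>. The restriction to \<open>{1..n}\<close>
  makes the flag extensional, as \<open>full_flags\<close> demands.\<close>

definition flag_of_perm :: "nat \<Rightarrow> (nat \<Rightarrow> nat) \<Rightarrow> nat \<Rightarrow> nat set" where
  "flag_of_perm n g = (\<lambda>i\<in>{1..n}. Hilbert_Choice.inv g ` {1..i})"

lemma flag_of_perm_in_full_flags:
  assumes g: "g permutes {1..n}"
  shows "flag_of_perm n g \<in> full_flags n"
proof -
  note inv = permutes_inv[OF g]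
  have sub: "Hilbert_Choice.inv g ` {1..i} \<subseteq> {1..n}" if "i \<le> n" for i
  proof -
    have "Hilbert_Choice.inv g ` {1..i} \<subseteq> Hilbert_Choice.inv g ` {1..n}"
      using that by (intro image_mono) auto
    then show ?thesis unfolding permutes_image[OF inv] .
  qed
  have card: "card (Hilbert_Choice.inv g ` {1..i}) = i" for i
    by (simp add: card_image permutes_inj_on[OF inv])
  have "{1..i} \<subset> {1..Suc i}" for i :: nat by auto
  then have mono: "Hilbert_Choice.inv g ` {1..i} \<subset> Hilbert_Choice.inv g ` {1..Suc i}" for i
    by (intro image_strict_mono permutes_inj_on[OF inv])
  show ?thesis
    unfolding full_flags_def flag_of_perm_def using sub card mono by (auto simp del: image_subset_iff)
qed

text \<open>The singleton \<open>{i}\<close> is the difference of two consecutive initial segments,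
  so the flag determines each value of the inverse permutation.\<close>

lemma inj_on_flag_of_perm: "inj_on (flag_of_perm n) {g. g permutes {1..n}}"
proof (rule inj_onI)
  fix g h assume "g \<in> {g. g permutes {1..n}}" "h \<in> {g. g permutes {1..n}}"
    and eq: "flag_of_perm n g = flag_of_perm n h"
  then have g: "g permutes {1..n}" and h: "h permutes {1..n}" by auto
  have seg: "Hilbert_Choice.inv g ` {1..i} = Hilbert_Choice.inv h ` {1..i}" if "i \<le> n" for i
    using fun_cong[OF eq, of i] that by (cases "i = 0") (auto simp: flag_of_perm_def)
  have "Hilbert_Choice.inv g i = Hilbert_Choice.inv h i" for i
  proof (cases "i \<in> {1..n}")
    case True
    then have "{i} = {1..i} - {1..i - 1}" by auto
    then have "p ` {i} = p ` {1..i} - p ` {1..i - 1}" if "inj p" for p :: "nat \<Rightarrow> nat"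
      using image_set_diff[OF that] by metis
    then show ?thesis
      using seg[of i] seg[of "i - 1"] True permutes_inj[OF permutes_inv[OF g]] permutes_inj[OF permutes_inv[OF h]]
      by (metis (no_types, lifting) atLeastAtMost_iff diff_le_self image_empty image_insert order_trans singleton_inject)
  next
    case False
    then show ?thesis using permutes_not_in[OF permutes_inv[OF g]] permutes_not_in[OF permutes_inv[OF h]] by metis
  qed
  then have "Hilbert_Choice.inv g = Hilbert_Choice.inv h" by auto
  then show "g = h" using permutes_inv_inv[OF g] permutes_inv_inv[OF h] by metis
qed

text \<open>Consecutive sets of a flag differ by one element. Listing these elements in order gives
  a permutation \<open>p\<close>, and the flag belongs to the inverse of \<open>p\<close>.\<close>

lemma full_flag_from_perm:
  assumes U: "U \<in> full_flags n"
  shows "\<exists>g. g permutes {1..n} \<and> flag_of_perm n g = U"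
proof -
  \<comment> \<open>The flag carries no set at index 0; the empty set is added there so that the
    first step also adds one element.\<close>
  define V where "V i = (if i = 0 then {} else U i)" for i
  have U_ext: "U \<in> {1..n} \<rightarrow>\<^sub>E Pow {1..n}" using U by (simp add: full_flags_def)
  have sub: "V i \<subseteq> {1..n}" and card: "card (V i) = i" if "i \<le> n" for i
    using U that by (auto simp: V_def full_flags_def PiE_iff)
  have fin: "finite (V i)" if "i \<le> n" for i using finite_subset[OF sub[OF that]] by simp
  have step: "V i \<subseteq> V (Suc i)" if "i < n" for i
    using U that by (auto simp: V_def full_flags_def)
  have "\<exists>x. V (Suc i) = insert x (V i) \<and> x \<notin> V i" if "i < n" for i
  proof -
    have "card (V (Suc i) - V i) = 1"
      using card_Diff_subset[OF fin step] card that by simp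
    then obtain x where "V (Suc i) - V i = {x}" by (meson card_1_singletonE)
    then show ?thesis using step[OF that] by blast
  qed
  then obtain q where q: "\<And>i. i < n \<Longrightarrow> V (Suc i) = insert (q i) (V i) \<and> q i \<notin> V i" by metis
  define p where "p i = (if i \<in> {1..n} then q (i - 1) else i)" for i
  have seg: "p ` {1..i} = V i" if "i \<le> n" for i
    using that
  proof (induction i)
    case (Suc i)
    have "{1..Suc i} = insert (Suc i) {1..i}" by auto
    then have "p ` {1..Suc i} = insert (p (Suc i)) (p ` {1..i})" by (simp only: image_insert)
    also have "\<dots> = insert (q i) (V i)" using Suc by (simp only: Suc_leD) (simp add: p_def)
    finally show ?case using q[of i] Suc.prems by simp
  qed (simp add: V_def)
  have "V n = {1..n}" using sub[of n] card[of n] by (intro card_subset_eq) auto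
  then have "p ` {1..n} = {1..n}" using seg[of n] by simp
  then have p: "p permutes {1..n}"
    by (intro bij_imp_permutes) (auto simp: bij_betw_def p_def eq_card_imp_inj_on)
  define g where "g = Hilbert_Choice.inv p"
  have "g permutes {1..n}" unfolding g_def by (rule permutes_inv[OF p])
  moreover have "flag_of_perm n g = U"
  proof (rule PiE_ext[OF _ U_ext])
    show "flag_of_perm n g \<in> {1..n} \<rightarrow>\<^sub>E Pow {1..n}"
      using flag_of_perm_in_full_flags[OF \<open>g permutes {1..n}\<close>] by (simp add: full_flags_def)
    fix i assume "i \<in> {1..n}"
    then show "flag_of_perm n g i = U i"
      using seg[of i] by (simp add: flag_of_perm_def g_def permutes_inv_inv[OF p] V_def)
  qed
  ultimately show ?thesis by blast
qed

lemma flags_differ_eq_breaks: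
  assumes g: "g permutes {1..n}" and h: "h permutes {1..n}"
  shows "{i \<in> {1..n}. flag_of_perm n g i \<noteq> flag_of_perm n h i} = breaks (h \<circ> Hilbert_Choice.inv g)"
proof -
  have "Hilbert_Choice.inv g ` X = Hilbert_Choice.inv h ` X \<longleftrightarrow> (h \<circ> Hilbert_Choice.inv g) ` X = X" for X
    using permutes_bij[OF h] by (metis bij_is_inj bij_is_surj image_comp image_f_inv_f image_inv_f_f)
  then have mem: "flag_of_perm n g i \<noteq> flag_of_perm n h i \<longleftrightarrow>
      i \<in> breaks (h \<circ> Hilbert_Choice.inv g)" if "i \<in> {1..n}" for i
    using that by (simp add: breaks_def flag_of_perm_def)
  have "breaks (h \<circ> Hilbert_Choice.inv g) \<subseteq> {1..n}"
    using breaks_subset[OF permutes_compose[OF permutes_inv[OF g] h]] by auto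
  then have "breaks (h \<circ> Hilbert_Choice.inv g) = {i \<in> {1..n}. i \<in> breaks (h \<circ> Hilbert_Choice.inv g)}"
    by blast
  also have "\<dots> = {i \<in> {1..n}. flag_of_perm n g i \<noteq> flag_of_perm n h i}"
    by (rule Collect_cong) (rule conj_cong[OF refl], rule mem[symmetric])
  finally show ?thesis by (rule sym)
qed

text \<open>The bijection \<open>flag_of_perm\<close> turns the number of differing sets into the
  number of breaks of \<open>h \<circ> inv g\<close>, and having \<open>k\<close> breaks
  characterises the generators.\<close>

lemma FJ_iso_cayley_graph:
  assumes k: "k \<le> n"
  shows "digraph_iso (with_proj (FJ n k))
    (with_proj (cayley_graph (sym_group n) (maximally_reducible_perms n k)))"
proof -
  let ?C = "with_proj (cayley_graph (sym_group n) (maximally_reducible_perms n k))"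
  let ?S = "{g. g permutes {1..n}}"
  define \<Phi> where "\<Phi> = \<lparr>iso_verts = flag_of_perm n, iso_arcs = map_prod (flag_of_perm n) (flag_of_perm n),
     iso_head = snd, iso_tail = fst\<rparr>"
  have adj: "(\<exists>\<sigma>\<in>maximally_reducible_perms n k. h = \<sigma> \<circ> g) \<longleftrightarrow>
      card {i \<in> {1..n}. flag_of_perm n g i \<noteq> flag_of_perm n h i} = k"
    if g: "g \<in> ?S" and h: "h \<in> ?S" for g h
  proof -
    have g': "g permutes {1..n}" and h': "h permutes {1..n}" using g h by auto
    have "h = \<sigma> \<circ> g \<longleftrightarrow> \<sigma> = h \<circ> Hilbert_Choice.inv g" for \<sigma>
    proof
      assume "h = \<sigma> \<circ> g"
      then show "\<sigma> = h \<circ> Hilbert_Choice.inv g" by (simp only: comp_assoc permutes_inv_o[OF g'] comp_id)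
    next
      assume "\<sigma> = h \<circ> Hilbert_Choice.inv g"
      then show "h = \<sigma> \<circ> g" by (simp only: comp_assoc permutes_inv_o[OF g'] comp_id)
    qed
    then have "(\<exists>\<sigma>\<in>maximally_reducible_perms n k. h = \<sigma> \<circ> g) \<longleftrightarrow>
        h \<circ> Hilbert_Choice.inv g \<in> maximally_reducible_perms n k" by simp
    then show ?thesis
      unfolding mem_maximally_reducible_perms_iff[OF k] flags_differ_eq_breaks[OF g' h']
      using permutes_compose[OF permutes_inv[OF g'] h'] by blast
  qed
  have arcs: "parcs (cayley_graph (sym_group n) (maximally_reducible_perms n k)) =
      {(g, h). g \<in> ?S \<and> h \<in> ?S \<and> card {i \<in> {1..n}. flag_of_perm n g i \<noteq> flag_of_perm n h i} = k}"
    using adj by (auto simp: cayley_graph_def sym_group_def)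
  have verts: "pverts (cayley_graph (sym_group n) (maximally_reducible_perms n k)) = ?S"
    by (simp add: cayley_graph_def sym_group_def)
  have image: "flag_of_perm n ` ?S = full_flags n"
  proof
    show "flag_of_perm n ` ?S \<subseteq> full_flags n" using flag_of_perm_in_full_flags by blast
    show "full_flags n \<subseteq> flag_of_perm n ` ?S" using full_flag_from_perm by blast
  qed
  have image_arcs: "parcs (FJ n k) = map_prod (flag_of_perm n) (flag_of_perm n) `
      parcs (cayley_graph (sym_group n) (maximally_reducible_perms n k))"
  proof (intro equalityI subsetI)
    fix e assume "e \<in> parcs (FJ n k)"
    then obtain U V where e: "e = (U, V)" "U \<in> flag_of_perm n ` ?S" "V \<in> flag_of_perm n ` ?S"
      "card {i \<in> {1..n}. U i \<noteq> V i} = k"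
      unfolding image by (auto simp only: FJ_def pair_pre_digraph.simps)
    then obtain g h where "U = flag_of_perm n g" "V = flag_of_perm n h" "g \<in> ?S" "h \<in> ?S" by blast
    with e show "e \<in> map_prod (flag_of_perm n) (flag_of_perm n) `
        parcs (cayley_graph (sym_group n) (maximally_reducible_perms n k))"
      unfolding arcs by (intro image_eqI[of _ _ "(g, h)"]) simp_all
  next
    fix e assume "e \<in> map_prod (flag_of_perm n) (flag_of_perm n) `
        parcs (cayley_graph (sym_group n) (maximally_reducible_perms n k))"
    then obtain g h where "e = (flag_of_perm n g, flag_of_perm n h)" "g \<in> ?S" "h \<in> ?S"
      "card {i \<in> {1..n}. flag_of_perm n g i \<noteq> flag_of_perm n h i} = k"
      unfolding arcs by (auto simp only: map_prod_simp)
    then show "e \<in> parcs (FJ n k)"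
      using flag_of_perm_in_full_flags by (simp add: FJ_def)
  qed
  have wf: "wf_digraph ?C"
    by unfold_locales (auto simp: arcs verts)
  have "inj_on (map_prod (flag_of_perm n) (flag_of_perm n))
      (parcs (cayley_graph (sym_group n) (maximally_reducible_perms n k)))"
    by (rule inj_on_subset[OF map_prod_inj_on[OF inj_on_flag_of_perm inj_on_flag_of_perm]])
       (unfold arcs, blast)
  then have "pre_digraph.digraph_isomorphism ?C \<Phi>"
    unfolding pre_digraph.digraph_isomorphism_def \<Phi>_def
    using wf inj_on_flag_of_perm[of n] by (simp add: verts)
  moreover have "pverts (FJ n k) = flag_of_perm n ` ?S"
    using image by (simp add: FJ_def)
  then have "with_proj (FJ n k) = app_iso \<Phi> ?C"
    unfolding app_iso_def \<Phi>_def with_proj_def by (simp add: image_arcs verts)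
  ultimately have "digraph_iso ?C (with_proj (FJ n k))"
    unfolding digraph_iso_def by (intro exI[of _ \<Phi>] conjI)
  with wf show ?thesis by (rule digraph_iso_swap)
qed

section \<open>Interpolation of functions on a path\<close>

text \<open>For \<open>h\<close> on \<open>{1..m}\<close>, \<open>interpolate m h\<close> is \<open>m\<close> times the stretching of \<open>h\<close> to \<open>{1..m+1}\<close> by
  linear interpolation; at both ends the weight of the undefined value is \<open>0\<close>.\<close>

definition interpolate :: "real \<Rightarrow> (nat \<Rightarrow> real) \<Rightarrow> nat \<Rightarrow> real" where
  "interpolate t h i = (real i - 1) * h (i - 1) + (t + 1 - real i) * h i"

text \<open>The value \<open>h k\<close> enters with weight \<open>k\<close> at \<open>k + 1\<close>
  and with weight \<open>m + 1 - k\<close> at \<open>k\<close>.\<close>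

lemma sum_interpolate:
  "(\<Sum>i=1..Suc m. interpolate (real m) h i) = (real m + 1) * (\<Sum>k=1..m. h k)"
proof -
  have "(\<Sum>i=1..Suc m. (real i - 1) * h (i - 1)) = (\<Sum>k=0..m. real k * h k)"
    by (simp add: sum.shift_bounds_cl_Suc_ivl del: sum.cl_ivl_Suc)
  also have "\<dots> = (\<Sum>k=1..m. real k * h k)"
    by (simp add: sum.atLeast_Suc_atMost)
  moreover have "(\<Sum>i=1..Suc m. (real m + 1 - real i) * h i) = (\<Sum>k=1..m. (real m + 1 - real k) * h k)"
    by simp
  ultimately have "(\<Sum>i=1..Suc m. interpolate (real m) h i) =
      (\<Sum>k=1..m. real k * h k + (real m + 1 - real k) * h k)"
    unfolding interpolate_def sum.distrib by (simp only:)
  also have "\<dots> = (\<Sum>k=1..m. (real m + 1) * h k)"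
    by (intro sum.cong refl) (simp add: algebra_simps)
  finally show ?thesis by (simp only: sum_distrib_left)
qed

text \<open>Termwise this is \<open>(p a + q b)^2 = (p + q) (p a^2 + q b^2) - p q (a - b)^2\<close>
  with \<open>p = i - 1\<close> and \<open>q = m + 1 - i\<close>, so that
  \<open>p + q = m\<close>.\<close>

lemma sum_interpolate_square:
  "(\<Sum>i=1..Suc m. (interpolate (real m) h i)\<^sup>2) = real m * (real m + 1) * (\<Sum>k=1..m. (h k)\<^sup>2)
    - (\<Sum>i=1..Suc m. (real i - 1) * (real m + 1 - real i) * (h (i - 1) - h i)\<^sup>2)"
proof -
  have "(interpolate (real m) h i)\<^sup>2 = real m * interpolate (real m) (\<lambda>k. (h k)\<^sup>2) i
      - (real i - 1) * (real m + 1 - real i) * (h (i - 1) - h i)\<^sup>2" for i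
    by (simp add: interpolate_def power2_eq_square algebra_simps)
  then show ?thesis
    by (simp only: sum_subtractf sum_distrib_left[symmetric] sum_interpolate mult.assoc)
qed

text \<open>The differences of a stretched function are the stretched differences, on a path with
  one point less. This reduces energies of stretched functions to sums of squares of stretched
  functions.\<close>

lemma interpolate_diff:
  assumes "i \<ge> 1"
  shows "interpolate t f i - interpolate t f (Suc i) = interpolate (t - 1) (\<lambda>k. f k - f (Suc k)) i"
  using assms by (cases i) (auto simp: interpolate_def algebra_simps)

text \<open>Half the Schreier energy, by \<open>energy_schreier\<close>; the weights come from
  counting the generators that move a point by one or by two places.\<close>

definition path_energy :: "nat \<Rightarrow> (nat \<Rightarrow> real) \<Rightarrow> real" where
  "path_energy n f = (real n - 2) * (\<Sum>i=1..<n. (f i - f (i + 1))\<^sup>2)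
     + 2 * (\<Sum>i=1..<n-1. (f i - f (i + 2))\<^sup>2)"

text \<open>With \<open>e i = d i + d (i + 1)\<close>, each summand is the square of
  \<open>(i - 1) e (i - 1) + (m - 1 - i) e i + 2 d i\<close>. Its exact expansion contains a
  nonpositive term in \<open>d (i - 1) - d (i + 1)\<close>, which is dropped; the remaining
  corrections cancel in the sum except at the two ends.\<close>

lemma interpolate_two_step:
  fixes d :: "nat \<Rightarrow> real"
  assumes "m \<ge> 2"
  shows "(\<Sum>i=1..<m. (interpolate (real m - 1) d i + interpolate (real m - 1) d (Suc i))\<^sup>2)
    \<le> real m * (real m - 1) * (\<Sum>i=1..<m-1. (d i + d (Suc i))\<^sup>2)
       + 2 * (real m - 1) * ((d 1)\<^sup>2 + (d (m - 1))\<^sup>2)"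
proof -
  obtain k where k: "m = Suc (Suc k)" using assms by (metis add_2_eq_Suc le_Suc_ex)
  define e where "e i = d i + d (Suc i)" for i
  have termwise: "(interpolate (real m - 1) d i + interpolate (real m - 1) d (Suc i))\<^sup>2 \<le>
      real m * interpolate (real k) (\<lambda>i. (e i)\<^sup>2) i + 2 * real m * (d i)\<^sup>2
      - 2 * ((real i - 1) * (d (i - 1))\<^sup>2 + (real m - 1 - real i) * (d (Suc i))\<^sup>2)"
    if "i \<in> {1..<m}" for i
  proof -
    have i: "i \<ge> 1" "real i \<le> real m - 1" using that by auto
    have "interpolate (real m - 1) d i + interpolate (real m - 1) d (Suc i) =
        (real i - 1) * (d (i - 1) + d i) + (real m - 1 - real i) * (d i + d (Suc i)) + 2 * d i"
      by (simp add: interpolate_def algebra_simps)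
    moreover have "((real i - 1) * (d (i - 1) + d i) + (real m - 1 - real i) * (d i + d (Suc i)) + 2 * d i)\<^sup>2 =
        real m * ((real i - 1) * (d (i - 1) + d i)\<^sup>2 + (real m - 1 - real i) * (d i + d (Suc i))\<^sup>2)
        + 2 * real m * (d i)\<^sup>2
        - 2 * ((real i - 1) * (d (i - 1))\<^sup>2 + (real m - 1 - real i) * (d (Suc i))\<^sup>2)
        - (real i - 1) * (real m - 1 - real i) * (d (i - 1) - d (Suc i))\<^sup>2"
      by (simp add: power2_eq_square algebra_simps)
    moreover have "0 \<le> (real i - 1) * (real m - 1 - real i) * (d (i - 1) - d (Suc i))\<^sup>2"
      using i by (intro mult_nonneg_nonneg) auto
    moreover have "interpolate (real k) (\<lambda>i. (e i)\<^sup>2) i =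
        (real i - 1) * (d (i - 1) + d i)\<^sup>2 + (real m - 1 - real i) * (d i + d (Suc i))\<^sup>2"
      using i(1) by (simp add: interpolate_def e_def k)
    ultimately show ?thesis by (simp only: distrib_left)
  qed
  have range: "{1..<m} = {1..Suc k}" "{1..<m-1} = {1..k}" using k by auto
  have "(\<Sum>i=1..Suc k. (real i - 1) * (d (i - 1))\<^sup>2) = (\<Sum>i=1..k. real i * (d i)\<^sup>2)"
  proof -
    have "(\<Sum>i=1..Suc k. (real i - 1) * (d (i - 1))\<^sup>2) = (\<Sum>i=0..k. real i * (d i)\<^sup>2)"
      by (simp add: sum.shift_bounds_cl_Suc_ivl del: sum.cl_ivl_Suc)
    also have "\<dots> = (\<Sum>i=1..k. real i * (d i)\<^sup>2)"
      by (simp add: sum.atLeast_Suc_atMost)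
    finally show ?thesis .
  qed
  moreover have "(\<Sum>i=1..Suc k. (real m - 1 - real i) * (d (Suc i))\<^sup>2) =
      (\<Sum>i=1..Suc k. (real m - real i) * (d i)\<^sup>2) - (real m - 1) * (d 1)\<^sup>2"
  proof -
    have "(\<Sum>i=1..Suc k. (real m - 1 - real i) * (d (Suc i))\<^sup>2) = (\<Sum>i=2..Suc (Suc k). (real m - real i) * (d i)\<^sup>2)"
      unfolding numeral_2_eq_2 One_nat_def sum.shift_bounds_cl_Suc_ivl by (simp add: algebra_simps)
    also have "\<dots> = (\<Sum>i=2..Suc k. (real m - real i) * (d i)\<^sup>2)" by (simp add: k)
    also have "\<dots> = (\<Sum>i=1..Suc k. (real m - real i) * (d i)\<^sup>2) - (real m - 1) * (d 1)\<^sup>2"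
      by (subst (2) sum.atLeast_Suc_atMost) (simp_all add: numeral_2_eq_2)
    finally show ?thesis .
  qed
  moreover have "(\<Sum>i=1..k. real i * (d i)\<^sup>2) = (\<Sum>i=1..Suc k. real i * (d i)\<^sup>2) - (real m - 1) * (d (m - 1))\<^sup>2"
    by (simp add: k)
  moreover have "(\<Sum>i=1..Suc k. real i * (d i)\<^sup>2) + (\<Sum>i=1..Suc k. (real m - real i) * (d i)\<^sup>2) = real m * (\<Sum>i=1..Suc k. (d i)\<^sup>2)"
    unfolding sum.distrib[symmetric] sum_distrib_left by (intro sum.cong) (auto simp: algebra_simps)
  \<comment> \<open>After the index shifts the weights \<open>i\<close> and \<open>m - i\<close> add
    up to \<open>m\<close> on every square; the correction accounts for the two end terms that the
    shifts lose.\<close>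
  ultimately have slack: "(\<Sum>i=1..Suc k. (real i - 1) * (d (i - 1))\<^sup>2 + (real m - 1 - real i) * (d (Suc i))\<^sup>2) =
     real m * (\<Sum>i=1..Suc k. (d i)\<^sup>2) - (real m - 1) * ((d 1)\<^sup>2 + (d (m - 1))\<^sup>2)"
    unfolding sum.distrib distrib_left by linarith
  have "(\<Sum>i=1..<m. (interpolate (real m - 1) d i + interpolate (real m - 1) d (Suc i))\<^sup>2) \<le>
      (\<Sum>i=1..<m. real m * interpolate (real k) (\<lambda>i. (e i)\<^sup>2) i + 2 * real m * (d i)\<^sup>2
      - 2 * ((real i - 1) * (d (i - 1))\<^sup>2 + (real m - 1 - real i) * (d (Suc i))\<^sup>2))"
    by (rule sum_mono) (rule termwise)
  also have "\<dots> = real m * (\<Sum>i=1..Suc k. interpolate (real k) (\<lambda>i. (e i)\<^sup>2) i)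
      + 2 * real m * (\<Sum>i=1..Suc k. (d i)\<^sup>2)
      - 2 * (\<Sum>i=1..Suc k. (real i - 1) * (d (i - 1))\<^sup>2 + (real m - 1 - real i) * (d (Suc i))\<^sup>2)"
    unfolding range by (simp only: sum.distrib sum_subtractf sum_distrib_left[symmetric])
  also have "\<dots> = real m * (real m - 1) * (\<Sum>i=1..<m-1. (d i + d (Suc i))\<^sup>2)
       + 2 * (real m - 1) * ((d 1)\<^sup>2 + (d (m - 1))\<^sup>2)"
    unfolding slack sum_interpolate range e_def by (simp add: k algebra_simps del: sum.cl_ivl_Suc)
  finally show ?thesis .
qed

text \<open>Stretching is almost an equality in Cauchy-Schwarz for smooth \<open>f\<close>; for rough \<open>f\<close> the deficit \<open>R\<close>
  is what pays for the boundary terms, through the parallelogram law.\<close>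

lemma path_energy_interpolate_le:
  assumes m: "m \<ge> 5" and \<gamma>: "\<gamma> \<le> 18 / 5"
    and f: "path_energy m f = \<gamma> * (\<Sum>i=1..m. (f i)\<^sup>2)"
  shows "path_energy (Suc m) (interpolate (real m) f) \<le> \<gamma> * (\<Sum>i=1..Suc m. (interpolate (real m) f i)\<^sup>2)"
proof -
  define d where "d i = f i - f (Suc i)" for i
  \<comment> \<open>\<open>P\<close> and \<open>Q\<close> make up the energy of \<open>f\<close>.
    \<open>R\<close> and \<open>W\<close> are the losses in the square identity for the stretched
    differences and for the stretched function itself.\<close>
  define P where "P = (\<Sum>i=1..<m. (d i)\<^sup>2)"
  define Q where "Q = (\<Sum>i=1..<m-1. (d i + d (Suc i))\<^sup>2)"
  define R where "R = (\<Sum>i=2..<m. (real i - 1) * (real m - real i) * (d (i - 1) - d i)\<^sup>2)"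
  define W where "W = (\<Sum>i=1..<m. real i * (real m - real i) * (d i)\<^sup>2)"
  let ?G = "interpolate (real m) f"
  let ?ends = "(d 1)\<^sup>2 + (d (m - 1))\<^sup>2"
  obtain k where k: "m = Suc k" using m by (cases m) auto
  have norm: "(\<Sum>i=1..Suc m. (?G i)\<^sup>2) = real m * (real m + 1) * (\<Sum>i=1..m. (f i)\<^sup>2) - W"
  proof -
    have "(\<Sum>i=1..Suc m. (real i - 1) * (real m + 1 - real i) * (f (i - 1) - f i)\<^sup>2) =
        (\<Sum>i=0..m. real i * (real m - real i) * (d i)\<^sup>2)"
      by (simp add: sum.shift_bounds_cl_Suc_ivl d_def del: sum.cl_ivl_Suc)
    also have "\<dots> = W"
      unfolding W_def by (rule sum.mono_neutral_right) (auto simp: le_less)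
    finally show ?thesis unfolding sum_interpolate_square by simp
  qed
  have P': "(\<Sum>i=1..<Suc m. (?G i - ?G (i + 1))\<^sup>2) = (real m - 1) * real m * P - R"
  proof -
    have "(\<Sum>i=1..<Suc m. (?G i - ?G (i + 1))\<^sup>2) = (\<Sum>i=1..Suc k. (interpolate (real k) d i)\<^sup>2)"
      using k by (intro sum.cong) (auto simp: interpolate_diff d_def[abs_def])
    also have "\<dots> = real k * (real k + 1) * (\<Sum>i=1..k. (d i)\<^sup>2)
        - (\<Sum>i=1..Suc k. (real i - 1) * (real k + 1 - real i) * (d (i - 1) - d i)\<^sup>2)"
      by (rule sum_interpolate_square)
    also have "(\<Sum>i=1..Suc k. (real i - 1) * (real k + 1 - real i) * (d (i - 1) - d i)\<^sup>2) = R"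
      unfolding R_def k by (rule sum.mono_neutral_cong_right) (auto simp: le_less)
    also have "(\<Sum>i=1..k. (d i)\<^sup>2) = P" unfolding P_def k by (simp add: atLeastLessThanSuc_atLeastAtMost)
    finally show ?thesis by (simp add: k)
  qed
  have Q': "(\<Sum>i=1..<Suc m - 1. (?G i - ?G (i + 2))\<^sup>2) \<le> real m * (real m - 1) * Q + 2 * (real m - 1) * ?ends"
  proof -
    have "?G i - ?G (i + 2) = interpolate (real m - 1) d i + interpolate (real m - 1) d (Suc i)"
      if "i \<ge> 1" for i
      using interpolate_diff[of i "real m" f] interpolate_diff[of "Suc i" "real m" f] that
      by (simp add: d_def[abs_def])
    then have "(\<Sum>i=1..<Suc m - 1. (?G i - ?G (i + 2))\<^sup>2) =
        (\<Sum>i=1..<m. (interpolate (real m - 1) d i + interpolate (real m - 1) d (Suc i))\<^sup>2)"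
      by (intro sum.cong) auto
    with interpolate_two_step[of m d] m show ?thesis by (simp add: Q_def)
  qed
  have Q_shift: "Q = (\<Sum>i=2..<m. (d (i - 1) + d i)\<^sup>2)"
  proof -
    have "Q = (\<Sum>i=Suc 1..<Suc (m - 1). (d (i - 1) + d i)\<^sup>2)"
      unfolding Q_def sum.shift_bounds_Suc_ivl by simp
    then show ?thesis using m by (simp add: numeral_2_eq_2)
  qed
  \<comment> \<open>Both the sum and the difference of neighbouring slopes get weight at least 12,
    giving 24 on the sum of their squares. For the difference, 12 is the value of
    \<open>(m - 1) (i - 1) (m - i)\<close> at \<open>m = 5\<close>, \<open>i = 2\<close>, and it is
    least there. Each slope occurs twice except for the two at the ends.\<close>
  have parallelogram: "24 * (2 * P - ?ends) \<le> 4 * real m * Q + (real m - 1) * R"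
  proof -
    have "24 * ((d (i - 1))\<^sup>2 + (d i)\<^sup>2) \<le> 4 * real m * (d (i - 1) + d i)\<^sup>2
        + (real m - 1) * ((real i - 1) * (real m - real i) * (d (i - 1) - d i)\<^sup>2)"
      if "i \<in> {2..<m}" for i
    proof -
      have i: "real i \<ge> 2" "real i \<le> real m - 1" using that by auto
      have "0 \<le> (real i - 2) * (real m - 1 - real i)" using i by (intro mult_nonneg_nonneg) auto
      then have "3 \<le> (real i - 1) * (real m - real i)" using m by (simp add: algebra_simps)
      then have "4 * 3 \<le> (real m - 1) * ((real i - 1) * (real m - real i))"
        using m by (intro mult_mono) auto
      then have "12 * (d (i - 1) - d i)\<^sup>2 \<le> (real m - 1) * ((real i - 1) * (real m - real i)) * (d (i - 1) - d i)\<^sup>2"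
        by (intro mult_right_mono) auto
      moreover have "12 * (d (i - 1) + d i)\<^sup>2 \<le> 4 * real m * (d (i - 1) + d i)\<^sup>2"
        using m by (intro mult_right_mono) auto
      ultimately show ?thesis by (simp add: power2_eq_square algebra_simps)
    qed
    then have "(\<Sum>i=2..<m. 24 * ((d (i - 1))\<^sup>2 + (d i)\<^sup>2)) \<le> (\<Sum>i=2..<m. 4 * real m * (d (i - 1) + d i)\<^sup>2
        + (real m - 1) * ((real i - 1) * (real m - real i) * (d (i - 1) - d i)\<^sup>2))"
      by (rule sum_mono)
    also have "\<dots> = 4 * real m * Q + (real m - 1) * R"
      by (simp only: Q_shift R_def sum.distrib sum_distrib_left)
    also have "(\<Sum>i=2..<m. 24 * ((d (i - 1))\<^sup>2 + (d i)\<^sup>2)) = 24 * (2 * P - ?ends)"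
    proof -
      have "(\<Sum>i=2..<m. (d i)\<^sup>2) = P - (d 1)\<^sup>2"
        unfolding P_def using m by (subst (2) sum.atLeast_Suc_lessThan) (auto simp: numeral_2_eq_2)
      moreover have "(\<Sum>i=2..<m. (d (i - 1))\<^sup>2) = P - (d (m - 1))\<^sup>2"
      proof -
        have "(\<Sum>i=2..<m. (d (i - 1))\<^sup>2) = (\<Sum>i=1..<k. (d i)\<^sup>2)"
          unfolding k numeral_2_eq_2 sum.shift_bounds_Suc_ivl by simp
        then show ?thesis using m by (simp add: P_def k)
      qed
      ultimately show ?thesis by (simp add: sum_distrib_left[symmetric] sum.distrib)
    qed
    finally show ?thesis .
  qed
  \<comment> \<open>What remains of the claim once \<open>parallelogram\<close> is inserted:
    \<open>m (m - 3)\<close> is \<open>m (m + 1) (m - 2) - m (m - 1)^2\<close>, and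
    \<open>4 m + 20\<close> is \<open>4 (m - 1) + 24\<close>. The comparison is made coefficient by
    coefficient in the squares of the \<open>d i\<close>, with \<open>b\<close> carrying the end
    terms.\<close>
  have quad: "(4 * real m + 20) * ?ends + \<gamma> * W \<le> (real m * (real m - 3) + 48) * P"
  proof -
    define b where "b i = (if i = 1 \<or> i = m - 1 then 4 * real m + 20 else 0)" for i
    have "(\<Sum>i=1..<m. (b i + \<gamma> * (real i * (real m - real i))) * (d i)\<^sup>2) \<le>
        (\<Sum>i=1..<m. (real m * (real m - 3) + 48) * (d i)\<^sup>2)"
    proof (intro sum_mono mult_right_mono)
      fix i assume i: "i \<in> {1..<m}"
      have nonneg: "0 \<le> real i * (real m - real i)" using i by auto
      have le: "\<gamma> * (real i * (real m - real i)) \<le> 18 / 5 * (real i * (real m - real i))"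
        using \<gamma> nonneg by (rule mult_right_mono)
      show "b i + \<gamma> * (real i * (real m - real i)) \<le> real m * (real m - 3) + 48"
      proof (cases "i = 1 \<or> i = m - 1")
        case True
        then have "real i * (real m - real i) = real m - 1" using m by auto
        \<comment> \<open>At the ends the requirement is \<open>m^2 - 10.6 m + 31.6 \<ge> 0\<close>,
          and completing the square leaves a positive constant.\<close>
        moreover have "0 \<le> (real m - 53 / 10)\<^sup>2" by simp
        ultimately show ?thesis using le True unfolding b_def power2_eq_square by (simp add: algebra_simps)
      next
        case False
        \<comment> \<open>Inside, \<open>i (m - i)\<close> is at most \<open>m^2 / 4\<close>. As
          \<gamma> is at most 18/5, this leaves \<open>m^2 / 10 - 3 m + 48\<close>, which is
          \<open>(m - 15)^2 / 10\<close> plus a positive constant.\<close>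
        have "0 \<le> (real m - 2 * real i)\<^sup>2" "0 \<le> (real m - 15)\<^sup>2" by simp_all
        then show ?thesis using le False unfolding b_def power2_eq_square by (simp add: algebra_simps)
      qed
    qed simp
    also have "(\<Sum>i=1..<m. (b i + \<gamma> * (real i * (real m - real i))) * (d i)\<^sup>2) = (\<Sum>i=1..<m. b i * (d i)\<^sup>2) + \<gamma> * W"
      by (simp only: W_def sum_distrib_left sum.distrib distrib_right mult.assoc)
    also have "(\<Sum>i=1..<m. b i * (d i)\<^sup>2) = (\<Sum>i\<in>{1, m - 1}. b i * (d i)\<^sup>2)"
      using m by (intro sum.mono_neutral_right) (auto simp: b_def)
    also have "\<dots> = (4 * real m + 20) * ?ends" using m by (simp add: b_def algebra_simps)
    finally show ?thesis by (simp add: P_def sum_distrib_left)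
  qed
  have E: "path_energy m f = (real m - 2) * P + 2 * Q"
    by (simp add: path_energy_def P_def Q_def d_def)
  have "path_energy (Suc m) ?G \<le> (real m - 1) * ((real m - 1) * real m * P - R)
      + 2 * (real m * (real m - 1) * Q + 2 * (real m - 1) * ?ends)"
    using P' Q' by (simp add: path_energy_def del: diff_Suc_1)
  also have "\<dots> \<le> real m * (real m + 1) * ((real m - 2) * P + 2 * Q) - \<gamma> * W"
    using quad parallelogram by (simp add: algebra_simps)
  also have "\<dots> = \<gamma> * (\<Sum>i=1..Suc m. (?G i)\<^sup>2)"
    unfolding norm E[symmetric] f by (simp add: algebra_simps)
  finally show ?thesis .
qed

section \<open>The generators with two breaks\<close>

abbreviation swap :: "'a \<Rightarrow> 'a \<Rightarrow> 'a \<Rightarrow> 'a" where "swap \<equiv> Transposition.transpose"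

text \<open>An injective map of a finite segment into itself is onto, so a break must send some
  point upwards across \<open>k\<close>. In this form the breaks of explicit permutations can be
  computed.\<close>

lemma mem_breaks_iff:
  assumes \<sigma>: "\<sigma> permutes {1..n}"
  shows "k \<in> breaks \<sigma> \<longleftrightarrow> (\<exists>x\<in>{1..k}. k < \<sigma> x)"
proof
  assume "k \<in> breaks \<sigma>"
  then obtain x where x: "x \<in> {1..k}" "\<sigma> x \<notin> {1..k}" using not_breakI[OF \<sigma>] by blast
  have "\<sigma> x \<ge> 1" using x(1) permutes_in_image[OF \<sigma>, of x] permutes_not_in[OF \<sigma>, of x] by force
  then show "\<exists>x\<in>{1..k}. k < \<sigma> x" using x by force
next
  assume "\<exists>x\<in>{1..k}. k < \<sigma> x"
  then obtain x where "\<sigma> x \<in> \<sigma> ` {1..k}" "\<sigma> x \<notin> {1..k}" by force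
  then show "k \<in> breaks \<sigma>" by (auto simp: breaks_def)
qed

lemma permutes_pair_cases:
  assumes "\<sigma> ` {a, b} = {a, b}"
  shows "\<sigma> a = a \<and> \<sigma> b = b \<or> \<sigma> a = b \<and> \<sigma> b = a"
  using assms by (auto simp: doubleton_eq_iff)

lemma permutes_triple:
  "\<sigma> permutes {a, b, c} \<longleftrightarrow>
    \<sigma> \<in> {id, swap b c, swap a b, swap a b \<circ> swap b c, swap a c, swap a c \<circ> swap b c}"
proof -
  have "{(x, p). x \<in> {b, c} \<and> p \<in> {p. p permutes {c}}} = {(b, id), (c, id)}" by auto
  then have "{p. p permutes {b, c}} = {id, swap b c}"
    unfolding permutes_insert by simp
  then have "{(x, p). x \<in> {a, b, c} \<and> p \<in> {p. p permutes {b, c}}} =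
      {(a, id), (a, swap b c), (b, id), (b, swap b c), (c, id), (c, swap b c)}"
    by blast
  then have "{p. p permutes {a, b, c}} =
      {id, swap b c, swap a b, swap a b \<circ> swap b c, swap a c, swap a c \<circ> swap b c}"
    unfolding permutes_insert[of a] by simp
  then show ?thesis by blast
qed

definition break_class :: "nat \<Rightarrow> nat \<Rightarrow> nat \<Rightarrow> (nat \<Rightarrow> nat) set" where
  "break_class n i j = {\<sigma>. \<sigma> permutes {1..n} \<and> breaks \<sigma> = {i, j}}"

text \<open>The pairs \<open>{i, i + 1}\<close> and \<open>{j, j + 1}\<close> lie between non-breaks
  and are invariant, and all other points are fixed. Each pair must be exchanged, for otherwise its
  break would disappear.\<close>

lemma break_class_far:
  assumes "1 \<le> i" "Suc i < j" "j < n"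
  shows "break_class n i j = {swap i (Suc i) \<circ> swap j (Suc j)}" (is "_ = {?\<tau>}")
proof (intro equalityI subsetI)
  fix \<sigma> assume "\<sigma> \<in> break_class n i j"
  then have \<sigma>: "\<sigma> permutes {1..n}" and br: "breaks \<sigma> = {i, j}" by (auto simp: break_class_def)
  have swapped: "\<sigma> k = Suc k \<and> \<sigma> (Suc k) = k" if k: "k \<in> {i, j}" for k
  proof -
    have "{k - 1<..Suc k} = {k, Suc k}" using k assms by auto
    moreover have "k - 1 \<notin> breaks \<sigma>" "Suc k \<notin> breaks \<sigma>" unfolding br using k assms by auto
    ultimately have "\<sigma> ` {k, Suc k} = {k, Suc k}" using between_not_breaks[OF \<sigma>] by metis
    moreover have "\<sigma> k \<noteq> k"
    proof
      assume "\<sigma> k = k"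
      have "\<sigma> ` {1..k - 1} = {1..k - 1}" using \<open>k - 1 \<notin> breaks \<sigma>\<close> by (simp add: breaks_def)
      moreover have "{1..k} = insert k {1..k - 1}" using k assms by auto
      ultimately have "k \<notin> breaks \<sigma>" using \<open>\<sigma> k = k\<close> by (simp add: breaks_def)
      then show False using br k by simp
    qed
    ultimately show ?thesis using permutes_pair_cases by metis
  qed
  have "\<sigma> k = k" if "k \<notin> {i, Suc i, j, Suc j}" for k
  proof (cases k)
    case 0
    then show ?thesis using permutes_not_in[OF \<sigma>, of 0] by simp
  next
    case (Suc l)
    have "k - 1 \<notin> breaks \<sigma>" "k \<notin> breaks \<sigma>" unfolding br using that Suc by auto
    then show ?thesis using fixed_if_not_breaks[OF \<sigma>] Suc by simp
  qed
  then have "\<sigma> = ?\<tau>"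
    using swapped assms by (auto simp: fun_eq_iff Transposition.transpose_def)
  then show "\<sigma> \<in> {?\<tau>}" by simp
next
  fix \<sigma> assume "\<sigma> \<in> {?\<tau>}"
  moreover have p: "?\<tau> permutes {1..n}"
    using assms by (intro permutes_compose permutes_swap_id) auto
  moreover have "breaks ?\<tau> = {i, j}"
  proof (rule Set.set_eqI)
    fix k
    show "k \<in> breaks ?\<tau> \<longleftrightarrow> k \<in> {i, j}"
      unfolding mem_breaks_iff[OF p] using assms
      by (force simp: Transposition.transpose_def split: if_splits)
  qed
  ultimately show "\<sigma> \<in> break_class n i j" by (simp add: break_class_def)
qed

text \<open>Everything happens on the three points from \<open>i\<close> to \<open>i + 2\<close>. Of
  the six permutations there, the identity and the two adjacent transpositions lack one of the
  breaks.\<close>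

lemma break_class_adjacent:
  assumes "1 \<le> i" "Suc i < n"
  shows "break_class n i (Suc i) = {swap i (i + 2), swap i (i + 1) \<circ> swap (i + 1) (i + 2),
    swap i (i + 2) \<circ> swap (i + 1) (i + 2)}" (is "_ = ?T")
proof (intro equalityI subsetI)
  fix \<sigma> assume "\<sigma> \<in> break_class n i (Suc i)"
  then have \<sigma>: "\<sigma> permutes {1..n}" and br: "breaks \<sigma> = {i, Suc i}" by (auto simp: break_class_def)
  have fix_outside: "\<sigma> k = k" if "k \<notin> {i, i + 1, i + 2}" for k
  proof (cases k)
    case 0
    then show ?thesis using permutes_not_in[OF \<sigma>, of 0] by simp
  next
    case (Suc l)
    have "k - 1 \<notin> breaks \<sigma>" "k \<notin> breaks \<sigma>" unfolding br using that Suc by auto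
    then show ?thesis using fixed_if_not_breaks[OF \<sigma>] Suc by simp
  qed
  have "\<sigma> permutes {i, i + 1, i + 2}"
    by (rule permutes_superset[OF \<sigma>]) (use fix_outside in auto)
  then have mem: "\<sigma> \<in> {id, swap (i + 1) (i + 2), swap i (i + 1), swap i (i + 1) \<circ> swap (i + 1) (i + 2),
      swap i (i + 2), swap i (i + 2) \<circ> swap (i + 1) (i + 2)}"
    unfolding permutes_triple .
  have "i \<in> breaks \<sigma>" "Suc i \<in> breaks \<sigma>" using br by auto
  then have "\<exists>x\<in>{1..i}. i < \<sigma> x" "\<exists>x\<in>{1..Suc i}. Suc i < \<sigma> x"
    unfolding mem_breaks_iff[OF \<sigma>] by auto
  then have "\<sigma> \<noteq> id" "\<sigma> \<noteq> swap (i + 1) (i + 2)" "\<sigma> \<noteq> swap i (i + 1)"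
    by (auto simp: Transposition.transpose_def split: if_splits)
  then show "\<sigma> \<in> ?T" using mem by auto
next
  fix \<sigma> assume T: "\<sigma> \<in> ?T"
  have triple: "\<sigma> permutes {i, i + 1, i + 2}" unfolding permutes_triple using T by blast
  then have p: "\<sigma> permutes {1..n}" by (rule permutes_subset) (use assms in auto)
  have up: "i < \<sigma> i" "Suc i < \<sigma> i \<or> Suc i < \<sigma> (Suc i)"
    using T by (auto simp: Transposition.transpose_def)
  have "breaks \<sigma> = {i, Suc i}"
  proof (rule Set.set_eqI)
    fix k
    have "\<not> k < \<sigma> x" if "k \<notin> {i, Suc i}" "x \<le> k" for x
    proof (cases "x \<in> {i, i + 1, i + 2}")
      case True
      then have "\<sigma> x \<in> {i, i + 1, i + 2}" using permutes_in_image[OF triple] by blast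
      then show ?thesis using that True by auto
    qed (use that permutes_not_in[OF triple] in auto)
    then show "k \<in> breaks \<sigma> \<longleftrightarrow> k \<in> {i, Suc i}"
      unfolding mem_breaks_iff[OF p] using assms(1) up by (metis atLeastAtMost_iff insert_iff le_SucI order_refl singletonD)
  qed
  with p show "\<sigma> \<in> break_class n i (Suc i)" by (simp add: break_class_def)
qed

lemma sum_break_class_adjacent:
  fixes \<phi> :: "(nat \<Rightarrow> nat) \<Rightarrow> real"
  assumes "1 \<le> i" "Suc i < n"
  shows "sum \<phi> (break_class n i (Suc i)) = \<phi> (swap i (i + 2)) +
    \<phi> (swap i (i + 1) \<circ> swap (i + 1) (i + 2)) + \<phi> (swap i (i + 2) \<circ> swap (i + 1) (i + 2))"
proof -
  \<comment> \<open>Values at \<open>i\<close> and \<open>i + 1\<close> that tell the three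
    permutations apart.\<close>
  have "swap i (i + 2) i = i + 2" "(swap i (i + 1) \<circ> swap (i + 1) (i + 2)) i = i + 1"
    "(swap i (i + 2) \<circ> swap (i + 1) (i + 2)) i = i + 2"
    "swap i (i + 2) (i + 1) = i + 1" "(swap i (i + 2) \<circ> swap (i + 1) (i + 2)) (i + 1) = i"
    by (simp_all add: Transposition.transpose_def)
  then have "swap i (i + 2) \<noteq> swap i (i + 1) \<circ> swap (i + 1) (i + 2)"
    "swap i (i + 2) \<noteq> swap i (i + 2) \<circ> swap (i + 1) (i + 2)"
    "swap i (i + 1) \<circ> swap (i + 1) (i + 2) \<noteq> swap i (i + 2) \<circ> swap (i + 1) (i + 2)"
    by (metis add_left_cancel numeral_eq_one_iff semiring_norm(85), metis add_cancel_left_right one_neq_zero,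
        metis add_left_cancel numeral_eq_one_iff semiring_norm(85))
  then show ?thesis
    unfolding break_class_adjacent[OF assms] by (simp add: add.assoc)
qed

lemma finite_break_class: "finite (break_class n i j)"
proof (rule finite_subset)
  show "break_class n i j \<subseteq> {\<sigma>. \<sigma> permutes {1..n}}" by (auto simp only: break_class_def)
qed (rule finite_permutations, simp)

lemma sum_maximally_reducible_perms_2:
  fixes \<phi> :: "(nat \<Rightarrow> nat) \<Rightarrow> real"
  assumes "n \<ge> 2"
  shows "sum \<phi> (maximally_reducible_perms n 2) = (\<Sum>i=1..<n. \<Sum>j=Suc i..<n. sum \<phi> (break_class n i j))"
proof -
  let ?I = "Sigma {1..<n} (\<lambda>i. {Suc i..<n})"
  have "maximally_reducible_perms n 2 = (\<Union>p\<in>?I. break_class n (fst p) (snd p))"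
  proof (intro equalityI subsetI)
    fix \<sigma> assume "\<sigma> \<in> maximally_reducible_perms n 2"
    then have \<sigma>: "\<sigma> permutes {1..n}" "card (breaks \<sigma>) = 2"
      using mem_maximally_reducible_perms_iff[OF assms] by auto
    then obtain i j where ij: "breaks \<sigma> = {i, j}" "i \<noteq> j" by (meson card_2_iff)
    then obtain a b where ab: "breaks \<sigma> = {a, b}" "a < b"
      by (metis insert_commute linorder_neqE_nat)
    have "(a, b) \<in> ?I" using breaks_subset[OF \<sigma>(1)] unfolding ab(1) using ab(2) by auto
    moreover have "\<sigma> \<in> break_class n a b" using \<sigma>(1) ab(1) by (simp add: break_class_def)
    ultimately show "\<sigma> \<in> (\<Union>p\<in>?I. break_class n (fst p) (snd p))" by (metis UN_I fst_conv snd_conv)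
  next
    fix \<sigma> assume "\<sigma> \<in> (\<Union>p\<in>?I. break_class n (fst p) (snd p))"
    then show "\<sigma> \<in> maximally_reducible_perms n 2"
      using mem_maximally_reducible_perms_iff[OF assms] by (auto simp: break_class_def)
  qed
  then have "sum \<phi> (maximally_reducible_perms n 2) =
      sum \<phi> (\<Union>p\<in>?I. break_class n (fst p) (snd p))" by simp
  also have "\<dots> = (\<Sum>p\<in>?I. sum \<phi> (break_class n (fst p) (snd p)))"
    by (rule sum.UNION_disjoint) (simp_all add: finite_break_class, auto simp: break_class_def doubleton_eq_iff)
  finally show ?thesis by (simp add: sum.Sigma case_prod_beta)
qed

text \<open>Each of the \<open>n - 1\<close> indices lies in \<open>n - 2\<close> pairs. This is
  where the weight \<open>n - 2\<close> in \<open>path_energy\<close> comes from.\<close>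

lemma sum_pairs:
  fixes x :: "nat \<Rightarrow> real"
  assumes "n \<ge> 1"
  shows "(\<Sum>i=1..<n. \<Sum>j=Suc i..<n. x i + x j) = (real n - 2) * (\<Sum>i=1..<n. x i)"
  using assms
proof (induction n rule: nat_induct_at_least)
  case (Suc n)
  have "(\<Sum>i=1..<Suc n. \<Sum>j=Suc i..<Suc n. x i + x j) = (\<Sum>i=1..<n. (\<Sum>j=Suc i..<n. x i + x j) + (x i + x n))"
    using Suc.hyps by simp
  also have "\<dots> = (real n - 2) * (\<Sum>i=1..<n. x i) + (\<Sum>i=1..<n. x i) + (real n - 1) * x n"
    using Suc by (simp add: sum.distrib of_nat_diff)
  also have "\<dots> = (real (Suc n) - 2) * (\<Sum>i=1..<Suc n. x i)"
    using Suc.hyps by (simp add: algebra_simps)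
  finally show ?case .
qed simp

lemma sum_moved:
  fixes f :: "nat \<Rightarrow> real"
  assumes "T \<subseteq> {1..n}" "\<And>x. x \<notin> T \<Longrightarrow> \<sigma> x = x"
  shows "(\<Sum>x=1..n. (f x - f (\<sigma> x))\<^sup>2) = (\<Sum>x\<in>T. (f x - f (\<sigma> x))\<^sup>2)"
  using assms by (intro sum.mono_neutral_right) auto

text \<open>Every class contributes \<open>2 (d i + d j)\<close>: from its one element if the breaks
  are apart, from the two 3-cycles if they are adjacent. The adjacent classes add
  \<open>4 e i\<close>, of which \<open>2 e i\<close> comes from the transposition.\<close>

lemma sum_energy_maximally_reducible_perms_2:
  fixes f :: "nat \<Rightarrow> real"
  assumes "n \<ge> 3"
  shows "(\<Sum>\<sigma>\<in>maximally_reducible_perms n 2. \<Sum>x=1..n. (f x - f (\<sigma> x))\<^sup>2) = 2 * path_energy n f"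
proof -
  define d where "d i = (f i - f (i + 1))\<^sup>2" for i
  define e where "e i = (f i - f (i + 2))\<^sup>2" for i
  define \<phi> where "\<phi> \<sigma> = (\<Sum>x=1..n. (f x - f (\<sigma> x))\<^sup>2)" for \<sigma>
  have class_sum: "sum \<phi> (break_class n i j) = 2 * (d i + d j) + (if j = Suc i then 4 * e i else 0)"
    if ij: "1 \<le> i" "i < j" "j < n" for i j
  proof (cases "j = Suc i")
    case True
    have moved: "\<phi> \<sigma> = (\<Sum>x\<in>{i, i + 1, i + 2}. (f x - f (\<sigma> x))\<^sup>2)"
      if "\<And>x. x \<notin> {i, i + 1, i + 2} \<Longrightarrow> \<sigma> x = x" for \<sigma>
      unfolding \<phi>_def using ij True that by (intro sum_moved) auto
    have "\<phi> (swap i (i + 2)) = 2 * e i"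
      "\<phi> (swap i (i + 1) \<circ> swap (i + 1) (i + 2)) = d i + d j + e i"
      "\<phi> (swap i (i + 2) \<circ> swap (i + 1) (i + 2)) = d i + d j + e i"
      by (subst moved, simp_all add: Transposition.transpose_def d_def e_def True power2_commute)+
    then show ?thesis
      using sum_break_class_adjacent[of i n \<phi>] ij True by simp
  next
    case False
    have "\<phi> (swap i (Suc i) \<circ> swap j (Suc j)) =
        (\<Sum>x\<in>{i, Suc i, j, Suc j}. (f x - f ((swap i (Suc i) \<circ> swap j (Suc j)) x))\<^sup>2)"
      unfolding \<phi>_def using ij False by (intro sum_moved) auto
    also have "\<dots> = 2 * (d i + d j)"
      using ij False by (simp add: Transposition.transpose_def d_def power2_commute)
    finally show ?thesis using break_class_far[of i j n] ij False by simp
  qed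
  have "sum \<phi> (maximally_reducible_perms n 2) =
      (\<Sum>i=1..<n. \<Sum>j=Suc i..<n. 2 * (d i + d j) + (if j = Suc i then 4 * e i else 0))"
    using assms by (subst sum_maximally_reducible_perms_2) (simp, intro sum.cong refl class_sum, auto)
  also have "\<dots> = 2 * (\<Sum>i=1..<n. \<Sum>j=Suc i..<n. d i + d j)
      + (\<Sum>i=1..<n. if Suc i < n then 4 * e i else 0)"
    by (simp add: sum.distrib sum_distrib_left mult.left_commute)
  also have "(\<Sum>i=1..<n. if Suc i < n then 4 * e i else 0) = 4 * (\<Sum>i=1..<n - 1. e i)"
    unfolding sum_distrib_left by (rule sum.mono_neutral_cong_right) auto
  also have "(\<Sum>i=1..<n. \<Sum>j=Suc i..<n. d i + d j) = (real n - 2) * (\<Sum>i=1..<n. d i)"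
    using assms by (intro sum_pairs) simp
  finally show ?thesis by (simp add: \<phi>_def path_energy_def d_def e_def)
qed

section \<open>Energies of actions\<close>

text \<open>One definition for both graphs: evaluation at points yields the Schreier graph, left
  multiplication the Cayley graph.\<close>

definition action_kernel :: "'s set \<Rightarrow> ('s \<Rightarrow> 'a \<Rightarrow> 'a) \<Rightarrow> 'a \<Rightarrow> 'a \<Rightarrow> real" where
  "action_kernel R act x y = real (card {\<sigma> \<in> R. act \<sigma> x = y})"

lemma sum_action_kernel:
  assumes "finite S" "finite R" "\<And>\<sigma>. \<sigma> \<in> R \<Longrightarrow> act \<sigma> x \<in> S"
  shows "(\<Sum>y\<in>S. action_kernel R act x y * h y) = (\<Sum>\<sigma>\<in>R. h (act \<sigma> x))"
proof -
  have "(\<Sum>y\<in>S. action_kernel R act x y * h y) = (\<Sum>y\<in>S. \<Sum>\<sigma>\<in>{\<sigma> \<in> R. act \<sigma> x = y}. h (act \<sigma> x))"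
    by (simp add: action_kernel_def)
  also have "\<dots> = (\<Sum>\<sigma>\<in>R. h (act \<sigma> x))"
    by (rule sum.group[OF assms(2,1)]) (use assms(3) in blast)
  finally show ?thesis .
qed

lemma laplacian_action:
  assumes "finite S" "finite R" "\<And>\<sigma>. \<sigma> \<in> R \<Longrightarrow> act \<sigma> x \<in> S"
  shows "laplacian S (action_kernel R act) f x = (\<Sum>\<sigma>\<in>R. f x - f (act \<sigma> x))"
  unfolding laplacian_def by (rule sum_action_kernel) (use assms in auto)

lemma energy_action:
  assumes "finite S" "finite R" "\<And>\<sigma> x. \<sigma> \<in> R \<Longrightarrow> x \<in> S \<Longrightarrow> act \<sigma> x \<in> S"
  shows "energy S (action_kernel R act) f = (\<Sum>\<sigma>\<in>R. \<Sum>x\<in>S. (f x - f (act \<sigma> x))\<^sup>2)"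
proof -
  have "energy S (action_kernel R act) f = (\<Sum>x\<in>S. \<Sum>\<sigma>\<in>R. (f x - f (act \<sigma> x))\<^sup>2)"
    unfolding energy_def using assms by (intro sum.cong refl sum_action_kernel) auto
  then show ?thesis by (subst sum.swap)
qed

text \<open>Inverting, written \<open>\<iota>\<close>, exchanges the generators from
  \<open>x\<close> to \<open>y\<close> with those from \<open>y\<close> to \<open>x\<close>.\<close>

lemma action_kernel_sym:
  assumes \<iota>: "\<And>\<sigma>. \<sigma> \<in> R \<Longrightarrow> \<iota> \<sigma> \<in> R \<and> \<iota> (\<iota> \<sigma>) = \<sigma>"
    and inv: "\<And>\<sigma> x. \<sigma> \<in> R \<Longrightarrow> act (\<iota> \<sigma>) (act \<sigma> x) = x"
  shows "action_kernel R act x y = action_kernel R act y x"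
proof -
  have "bij_betw \<iota> {\<sigma> \<in> R. act \<sigma> x = y} {\<sigma> \<in> R. act \<sigma> y = x}"
    by (rule bij_betw_byWitness[where f' = \<iota>]) (use \<iota> inv in force)+
  then show ?thesis by (simp add: action_kernel_def bij_betw_same_card)
qed

section \<open>Sums over cosets of point stabilisers, and the gap on three points\<close>

text \<open>Generators multiply from the left, so cosets with the subgroup on the left are wanted.
  Inverting all permutations before and after applying \<open>sum_over_permutations_insert\<close>
  moves the transposition to the right.\<close>

lemma sum_permutes_coset:
  assumes "finite T" "a \<notin> T"
  shows "sum \<Phi> {g. g permutes insert a T} =
    (\<Sum>b\<in>insert a T. \<Sum>h | h permutes T. \<Phi> (h \<circ> swap a b))"
proof -
  have "sum \<Phi> {g. g permutes insert a T} = (\<Sum>g | g permutes insert a T. \<Phi> (Hilbert_Choice.inv g))"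
    by (rule sum_permutations_inverse)
  also have "\<dots> = (\<Sum>b\<in>insert a T. \<Sum>h | h permutes T. \<Phi> (Hilbert_Choice.inv (swap a b \<circ> h)))"
    by (rule sum_over_permutations_insert[OF assms])
  also have "\<dots> = (\<Sum>b\<in>insert a T. \<Sum>h | h permutes T. \<Phi> (Hilbert_Choice.inv h \<circ> swap a b))"
    by (intro sum.cong refl) (simp add: o_inv_distrib permutes_bij)
  also have "\<dots> = (\<Sum>b\<in>insert a T. \<Sum>h | h permutes T. \<Phi> (h \<circ> swap a b))"
    by (subst (2) sum_permutations_inverse) simp
  finally show ?thesis .
qed

text \<open>Since every \<open>h\<close> fixes \<open>a\<close>, the coset of
  \<open>swap a b\<close> consists of exactly the permutations that send \<open>b\<close> to
  \<open>a\<close>.\<close>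

lemma sum_coset_eq_fibre:
  assumes "finite T" "a \<notin> T" "b \<in> insert a T"
  shows "(\<Sum>h | h permutes T. \<Phi> (h \<circ> swap a b)) =
    (\<Sum>g | g permutes insert a T. if g b = a then \<Phi> g else (0::real))"
proof -
  have eq: "(h \<circ> swap a c) b = a \<longleftrightarrow> c = b" if "h permutes T" for h c
  proof -
    have "h a = a" using permutes_not_in[OF that assms(2)] .
    then have "(h \<circ> swap a c) b = a \<longleftrightarrow> swap a c b = a"
      using permutes_inj[OF that] by (metis comp_apply injD)
    then show ?thesis by (auto simp: Transposition.transpose_def)
  qed
  have "(\<Sum>g | g permutes insert a T. if g b = a then \<Phi> g else 0) =
      (\<Sum>c\<in>insert a T. \<Sum>h | h permutes T. if c = b then \<Phi> (h \<circ> swap a c) else 0)"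
    unfolding sum_permutes_coset[OF assms(1,2)] by (intro sum.cong refl) (simp add: eq del: comp_apply)
  also have "\<dots> = (\<Sum>c\<in>insert a T. if c = b then \<Sum>h | h permutes T. \<Phi> (h \<circ> swap a c) else 0)"
    by (intro sum.cong refl) simp
  also have "\<dots> = (\<Sum>h | h permutes T. \<Phi> (h \<circ> swap a b))"
    using assms by simp
  finally show ?thesis ..
qed

text \<open>Write \<open>x\<close> and \<open>y\<close> for the values of \<open>\<Phi>\<close> on the three even and the three odd permutations,
  paired by left multiplication with \<open>(a c)\<close>. Since the two sums are opposite, the difference of the
  two sides is a positive combination of the variances of \<open>x\<close>, \<open>y\<close> and \<open>x - y\<close>.\<close>

lemma symmetric_group_3_gap:
  fixes \<Phi> :: "('a \<Rightarrow> 'a) \<Rightarrow> real"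
  assumes dist: "distinct [a, b, c]" and zero: "(\<Sum>h | h permutes {a, b, c}. \<Phi> h) = 0"
  shows "4 * (\<Sum>h | h permutes {a, b, c}. (\<Phi> h)\<^sup>2) \<le>
    (\<Sum>h | h permutes {a, b, c}. (\<Phi> h - \<Phi> (swap a c \<circ> h))\<^sup>2) +
    (\<Sum>h | h permutes {a, b, c}. (\<Phi> h - \<Phi> (swap a b \<circ> swap b c \<circ> h))\<^sup>2) +
    (\<Sum>h | h permutes {a, b, c}. (\<Phi> h - \<Phi> (swap a c \<circ> swap b c \<circ> h))\<^sup>2)"
proof -
  define u v w r s where "u = swap b c" and "v = swap a b" and "w = swap a c"
    and "r = swap a b \<circ> swap b c" and "s = swap a c \<circ> swap b c"
  note defs = u_def v_def w_def r_def s_def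
  have ne: "a \<noteq> b" "a \<noteq> c" "b \<noteq> c" using dist by auto
  \<comment> \<open>The images of \<open>a\<close> and \<open>b\<close> already tell the six
    permutations apart.\<close>
  have "distinct (map (\<lambda>p. (p a, p b)) [id, u, v, r, w, s])"
    using ne by (simp add: defs Transposition.transpose_def)
  then have "distinct [id, u, v, r, w, s]" by (rule distinct_map[THEN iffD1, THEN conjunct1])
  moreover have "{h. h permutes {a, b, c}} = set [id, u, v, r, w, s]"
    by (auto simp only: permutes_triple defs list.set)
  ultimately have sum6: "(\<Sum>h | h permutes {a, b, c}. g h) = g id + g u + g v + g r + g w + g s"
    for g :: "('a \<Rightarrow> 'a) \<Rightarrow> real"
    by (simp only: sum.distinct_set_conv_list) simp
  have w: "w \<circ> u = s" "w \<circ> v = r" "w \<circ> r = v" "w \<circ> w = id" "w \<circ> s = u"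
    and r: "r \<circ> u = v" "r \<circ> v = w" "r \<circ> r = s" "r \<circ> w = u" "r \<circ> s = id"
    and s: "s \<circ> u = w" "s \<circ> v = u" "s \<circ> r = id" "s \<circ> w = v" "s \<circ> s = r"
    using ne by (auto simp: defs fun_eq_iff Transposition.transpose_def)
  have e: "\<Phi> id = - (\<Phi> u + \<Phi> v + \<Phi> r + \<Phi> w + \<Phi> s)"
    using zero unfolding sum6 by simp
  \<comment> \<open>Three times the sum of squared deviations from the mean. It is applied to the
    even values at \<open>id, r, s\<close>, to the odd values at \<open>w, v, u\<close>, which are
    their products with \<open>w\<close> in the same order, and to the differences.\<close>
  have nonneg: "0 \<le> (x - y)\<^sup>2 + (y - z)\<^sup>2 + (x - z)\<^sup>2" for x y z :: real by simp
  from nonneg[of "\<Phi> id" "\<Phi> r" "\<Phi> s"] nonneg[of "\<Phi> w" "\<Phi> v" "\<Phi> u"]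
    nonneg[of "\<Phi> id - \<Phi> w" "\<Phi> r - \<Phi> v" "\<Phi> s - \<Phi> u"]
  show ?thesis
    unfolding sum6 unfolding r_def[symmetric] s_def[symmetric] unfolding w_def[symmetric]
    unfolding comp_id w r s e by (simp add: power2_eq_square algebra_simps)
qed

section \<open>The weights of the Schreier and the Cayley graph\<close>

abbreviation R2 :: "nat \<Rightarrow> (nat \<Rightarrow> nat) set" where "R2 n \<equiv> maximally_reducible_perms n 2"
abbreviation Sym :: "nat \<Rightarrow> (nat \<Rightarrow> nat) set" where "Sym n \<equiv> {g. g permutes {1..n}}"

definition schreier_kernel :: "nat \<Rightarrow> nat \<Rightarrow> nat \<Rightarrow> real" where
  "schreier_kernel n = action_kernel (R2 n) (\<lambda>\<sigma> i. \<sigma> i)"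

definition cayley_kernel :: "nat \<Rightarrow> (nat \<Rightarrow> nat) \<Rightarrow> (nat \<Rightarrow> nat) \<Rightarrow> real" where
  "cayley_kernel n = action_kernel (R2 n) (\<lambda>\<sigma> g. \<sigma> \<circ> g)"

lemma R2_permutes: "\<sigma> \<in> R2 n \<Longrightarrow> \<sigma> permutes {1..n}"
  by (simp add: maximally_reducible_perms_def)

lemma finite_Sym: "finite (Sym n)"
  by (rule finite_permutations) simp

lemma finite_R2: "finite (R2 n)"
  by (rule finite_subset[OF _ finite_Sym[of n]]) (use R2_permutes in blast)

lemma R2_in_range: "\<sigma> \<in> R2 n \<Longrightarrow> i \<in> {1..n} \<Longrightarrow> \<sigma> i \<in> {1..n}"
  using permutes_in_image[OF R2_permutes] by blast

lemma R2_comp_Sym: "\<sigma> \<in> R2 n \<Longrightarrow> g \<in> Sym n \<Longrightarrow> \<sigma> \<circ> g \<in> Sym n"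
  using permutes_compose[OF _ R2_permutes] by blast

lemma R2_inv:
  assumes "n \<ge> 2" "\<sigma> \<in> R2 n"
  shows "Hilbert_Choice.inv \<sigma> \<in> R2 n"
  using assms permutes_inv[of \<sigma> "{1..n}"] breaks_inv[of \<sigma> "{1..n}"]
  by (simp add: mem_maximally_reducible_perms_iff)

text \<open>An added fixed point creates no break. The energy on \<open>Suc n\<close> points
  therefore contains the terms of the generators on \<open>n\<close> points.\<close>

lemma R2_mono:
  assumes "n \<ge> 2"
  shows "R2 n \<subseteq> R2 (Suc n)"
proof
  fix \<sigma> assume "\<sigma> \<in> R2 n"
  then have \<sigma>: "\<sigma> permutes {1..n}" "card (breaks \<sigma>) = 2"
    using mem_maximally_reducible_perms_iff[OF assms] by auto
  have "\<sigma> permutes {1..Suc n}" by (rule permutes_subset[OF \<sigma>(1)]) auto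
  then show "\<sigma> \<in> R2 (Suc n)"
    using mem_maximally_reducible_perms_iff[of 2 "Suc n"] \<sigma>(2) assms by simp
qed

lemma schreier_kernel_sym: "n \<ge> 2 \<Longrightarrow> schreier_kernel n i j = schreier_kernel n j i"
  unfolding schreier_kernel_def
  by (rule action_kernel_sym[where \<iota> = Hilbert_Choice.inv])
    (auto simp: R2_inv permutes_inv_inv[OF R2_permutes] permutes_inverses[OF R2_permutes])

lemma cayley_kernel_sym: "n \<ge> 2 \<Longrightarrow> cayley_kernel n g h = cayley_kernel n h g"
  unfolding cayley_kernel_def
  by (rule action_kernel_sym[where \<iota> = Hilbert_Choice.inv])
    (auto simp: R2_inv permutes_inv_inv[OF R2_permutes] comp_assoc[symmetric] permutes_inv_o[OF R2_permutes])

lemma energy_schreier: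
  assumes "n \<ge> 3"
  shows "energy {1..n} (schreier_kernel n) f = 2 * path_energy n f"
  unfolding schreier_kernel_def sum_energy_maximally_reducible_perms_2[OF assms, symmetric]
  by (rule energy_action) (use finite_R2 R2_in_range in blast)+

lemma energy_cayley:
  "energy (Sym n) (cayley_kernel n) F = (\<Sum>\<sigma>\<in>R2 n. \<Sum>g\<in>Sym n. (F g - F (\<sigma> \<circ> g))\<^sup>2)"
  unfolding cayley_kernel_def by (rule energy_action) (use finite_R2 finite_Sym R2_comp_Sym in blast)+

section \<open>The spectral gap of the Schreier graph\<close>

lemma schreier_gap_upper:
  assumes "n \<ge> 3" and gap: "spectral_gap {1..n} (schreier_kernel n) \<gamma>"
    and "(\<Sum>i=1..n. f i) = 0" and "path_energy n f \<le> c * (\<Sum>i=1..n. (f i)\<^sup>2)" and "0 < (\<Sum>i=1..n. (f i)\<^sup>2)"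
  shows "\<gamma> \<le> c"
proof -
  have "2 * \<gamma> * (\<Sum>i=1..n. (f i)\<^sup>2) \<le> 2 * path_energy n f"
    using gap assms(3) energy_schreier[OF assms(1)] by (simp add: spectral_gap_def)
  then have "\<gamma> * (\<Sum>i=1..n. (f i)\<^sup>2) \<le> c * (\<Sum>i=1..n. (f i)\<^sup>2)" using assms(4) by simp
  then show ?thesis using assms(5) by simp
qed

lemma path_energy_eigenfunction:
  assumes "n \<ge> 3" and "centred_eigenfunction {1..n} (schreier_kernel n) \<gamma> f"
  shows "path_energy n f = \<gamma> * (\<Sum>i=1..n. (f i)\<^sup>2)"
proof -
  have "energy {1..n} (schreier_kernel n) f = 2 * \<gamma> * (\<Sum>i=1..n. (f i)\<^sup>2)"
    by (rule energy_eigenfunction[OF _ assms(2)]) (use assms(1) schreier_kernel_sym in simp)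
  then show ?thesis using energy_schreier[OF assms(1)] by simp
qed

text \<open>For \<open>n = 4\<close> only the pair of 1 and 4 is missing from a complete graph of
  weight 2. On centred functions the path energy hence exceeds 4 times the norm by exactly the sum
  of squares used below, which vanishes for \<open>?f\<close>.\<close>

lemma schreier_gap_4:
  assumes "spectral_gap {1..4} (schreier_kernel 4) \<gamma>"
  shows "\<gamma> \<le> 4" and "4 \<le> \<gamma>"
proof -
  have range: "{1..4} = {1, 2, 3, 4::nat}" "{1..<4} = {1, 2, 3::nat}" "{1..<4-1} = {1, 2::nat}" by auto
  let ?f = "\<lambda>i::nat. if i = 1 then 1 else if i = 4 then -1 else 0 :: real"
  show "\<gamma> \<le> 4"
    by (rule schreier_gap_upper[OF _ assms, of ?f]) (simp_all only: path_energy_def range, simp_all)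
  obtain f where f: "centred_eigenfunction {1..4} (schreier_kernel 4) \<gamma> f"
    using assms by (auto simp: spectral_gap_def)
  then have "sum f {1..4} = 0" by (simp only: centred_eigenfunction_def)
  then have f4: "f 4 = - (f 1 + f 2 + f 3)" unfolding range by simp
  have "0 \<le> 4 * (f 2)\<^sup>2 + 4 * (f 3)\<^sup>2 + 2 * (f 1 + f 4)\<^sup>2" by simp
  then have "4 * (\<Sum>i=1..4. (f i)\<^sup>2) \<le> path_energy 4 f"
    unfolding path_energy_def range by (simp add: f4 power2_eq_square algebra_simps flip: numeral_2_eq_2)
  also have "\<dots> = \<gamma> * (\<Sum>i=1..4. (f i)\<^sup>2)" by (rule path_energy_eigenfunction[OF _ f]) simp
  finally show "4 \<le> \<gamma>"
    using eigenfunction_norm_pos[OF _ f] by simp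
qed

text \<open>The linear function \<open>2, 1, 0, -1, -2\<close> has path energy 36 and squared norm
  10.\<close>

lemma schreier_gap_5:
  assumes "spectral_gap {1..5} (schreier_kernel 5) \<gamma>"
  shows "\<gamma> \<le> 18 / 5"
proof -
  have range: "{1..5} = {1, 2, 3, 4, 5::nat}" "{1..<5} = {1, 2, 3, 4::nat}" "{1..<5-1} = {1, 2, 3::nat}" by auto
  show ?thesis
    by (rule schreier_gap_upper[OF _ assms, of "\<lambda>i. 3 - real i"]) (simp_all only: path_energy_def range, simp_all)
qed

lemma schreier_gap_exists:
  assumes "n \<ge> 2"
  shows "\<exists>\<gamma>. spectral_gap {1..n} (schreier_kernel n) \<gamma>"
  by (rule spectral_gap_exists[of _ 1 n, OF _ _ _ _ schreier_kernel_sym[OF assms]]) (use assms in auto)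

lemma schreier_gap_Suc_le:
  assumes m: "m \<ge> 5" and gap: "spectral_gap {1..m} (schreier_kernel m) \<gamma>" and \<gamma>: "\<gamma> \<le> 18 / 5"
    and gap': "spectral_gap {1..Suc m} (schreier_kernel (Suc m)) \<gamma>'"
  shows "\<gamma>' \<le> \<gamma>"
proof -
  obtain f where f: "centred_eigenfunction {1..m} (schreier_kernel m) \<gamma> f"
    using gap by (auto simp: spectral_gap_def)
  let ?G = "interpolate (real m) f"
  have "path_energy m f = \<gamma> * (\<Sum>i=1..m. (f i)\<^sup>2)"
    using path_energy_eigenfunction[OF _ f] m by simp
  then have le: "path_energy (Suc m) ?G \<le> \<gamma> * (\<Sum>i=1..Suc m. (?G i)\<^sup>2)"
    by (rule path_energy_interpolate_le[OF m \<gamma>])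
  have zero: "(\<Sum>i=1..Suc m. ?G i) = 0"
    unfolding sum_interpolate using f by (simp add: centred_eigenfunction_def)
  have "\<exists>i\<in>{1..Suc m}. ?G i \<noteq> 0"
  proof (rule ccontr)
    assume "\<not> ?thesis"
    then have G0: "?G i = 0" if "1 \<le> i" "i \<le> Suc m" for i using that by auto
    \<comment> \<open>Stretching is injective: \<open>?G (i + 1)\<close> is
      \<open>i * f i + (m - i) * f (i + 1)\<close>, so the values of \<open>f\<close> are recovered
      one after another from the left.\<close>
    have "f i = 0" if "1 \<le> i" "i \<le> m" for i
      using that
    proof (induction i rule: nat_induct_at_least)
      case base
      then show ?case using G0[of 1] m by (simp add: interpolate_def)
    next
      case (Suc i)
      then show ?case using G0[of "Suc i"] by (simp add: interpolate_def)
    qed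
    then show False using f by (auto simp: centred_eigenfunction_def)
  qed
  then have "0 < (\<Sum>i=1..Suc m. (?G i)\<^sup>2)"
    using sum_square_pos[of "{1..Suc m}" _ ?G] by (metis finite_atLeastAtMost)
  then show ?thesis using schreier_gap_upper[OF _ gap' zero le] m by simp
qed

lemma schreier_gap_le:
  assumes "n \<ge> 5" and "spectral_gap {1..n} (schreier_kernel n) \<gamma>"
  shows "\<gamma> \<le> 18 / 5"
  using assms
proof (induction n arbitrary: \<gamma> rule: nat_induct_at_least)
  case base
  then show ?case using schreier_gap_5 by simp
next
  case (Suc n)
  obtain \<delta> where \<delta>: "spectral_gap {1..n} (schreier_kernel n) \<delta>"
    using schreier_gap_exists[of n] Suc.hyps by auto
  then have "\<delta> \<le> 18 / 5" by (rule Suc.IH)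
  then show ?case using schreier_gap_Suc_le[OF Suc.hyps \<delta> _ Suc.prems] by simp
qed

text \<open>The gap is 4 on four points, above the 18/5 that the interpolation estimate assumes. The
  first step is therefore read off from explicit bounds, and interpolation takes over from five
  points on.\<close>

lemma schreier_gap_antimono:
  assumes "n \<ge> 4" and gap: "spectral_gap {1..n} (schreier_kernel n) \<gamma>"
    and gap': "spectral_gap {1..Suc n} (schreier_kernel (Suc n)) \<gamma>'"
  shows "\<gamma>' \<le> \<gamma>"
proof (cases "n = 4")
  case True
  then have "4 \<le> \<gamma>" "\<gamma>' \<le> 18 / 5"
    using schreier_gap_4(2)[of \<gamma>] schreier_gap_5[of \<gamma>'] gap gap' by simp_all
  then show ?thesis by simp
next
  case False
  then have "n \<ge> 5" using assms(1) by simp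
  then show ?thesis using schreier_gap_Suc_le[OF _ gap _ gap'] schreier_gap_le[OF _ gap] by simp
qed

section \<open>The spectral gap of the Cayley graph\<close>

text \<open>The push-forward of \<open>F\<close> along \<open>g \<mapsto> g i\<close>, which maps
  the Cayley graph equivariantly to the Schreier graph.\<close>

definition fibre_sum :: "nat \<Rightarrow> ((nat \<Rightarrow> nat) \<Rightarrow> real) \<Rightarrow> nat \<Rightarrow> nat \<Rightarrow> real" where
  "fibre_sum n F i j = (\<Sum>g\<in>Sym n. if g i = j then F g else 0)"

text \<open>Orthogonality to all indicator functions of \<open>g i = j\<close>: such functions
  belong to the part of the Cayley spectrum that push-forwards to the Schreier graph cannot
  see.\<close>

definition balanced :: "nat \<Rightarrow> ((nat \<Rightarrow> nat) \<Rightarrow> real) \<Rightarrow> bool" where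
  "balanced n F \<longleftrightarrow> (\<forall>i\<in>{1..n}. \<forall>j\<in>{1..n}. fibre_sum n F i j = 0)"

lemma balanced_coset_sum:
  assumes F: "balanced n F" and T: "{1..n} = insert a T" "a \<notin> T" and b: "b \<in> insert a T"
  shows "(\<Sum>h | h permutes T. F (h \<circ> swap a b)) = 0"
proof -
  have "finite T" using T(1) by (metis finite_atLeastAtMost finite_insert)
  then have "(\<Sum>h | h permutes T. F (h \<circ> swap a b)) = fibre_sum n F b a"
    unfolding fibre_sum_def T(1) by (rule sum_coset_eq_fibre[OF _ T(2) b])
  then show ?thesis using F b T(1) by (auto simp: balanced_def)
qed

text \<open>On every coset of \<open>Sym n\<close> the function is centred, so the gap for
  \<open>n\<close> applies there. Left multiplication by \<open>R2 n\<close> stays inside a coset,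
  and the further generators of \<open>R2 (Suc n)\<close> only add nonnegative terms.\<close>

lemma balanced_energy_Suc:
  assumes "n \<ge> 2" and gap: "spectral_gap (Sym n) (cayley_kernel n) \<gamma>" and F: "balanced (Suc n) F"
  shows "2 * \<gamma> * (\<Sum>g\<in>Sym (Suc n). (F g)\<^sup>2) \<le> energy (Sym (Suc n)) (cayley_kernel (Suc n)) F"
proof -
  have ins: "{1..Suc n} = insert (Suc n) {1..n}" "Suc n \<notin> {1..n}" by auto
  note coset = sum_permutes_coset[OF finite_atLeastAtMost ins(2), folded ins(1)]
  have "2 * \<gamma> * (\<Sum>g\<in>Sym (Suc n). (F g)\<^sup>2) =
      (\<Sum>b\<in>{1..Suc n}. 2 * \<gamma> * (\<Sum>h\<in>Sym n. (F (h \<circ> swap (Suc n) b))\<^sup>2))"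
    unfolding coset sum_distrib_left ..
  also have "\<dots> \<le> (\<Sum>b\<in>{1..Suc n}. energy (Sym n) (cayley_kernel n) (\<lambda>h. F (h \<circ> swap (Suc n) b)))"
  proof (rule sum_mono)
    fix b assume "b \<in> {1..Suc n}"
    then have "(\<Sum>h\<in>Sym n. F (h \<circ> swap (Suc n) b)) = 0"
      by (intro balanced_coset_sum[OF F ins]) (simp only: ins(1))
    with gap show "2 * \<gamma> * (\<Sum>h\<in>Sym n. (F (h \<circ> swap (Suc n) b))\<^sup>2) \<le>
        energy (Sym n) (cayley_kernel n) (\<lambda>h. F (h \<circ> swap (Suc n) b))"
      by (simp add: spectral_gap_def)
  qed
  also have "\<dots> = (\<Sum>\<sigma>\<in>R2 n. \<Sum>g\<in>Sym (Suc n). (F g - F (\<sigma> \<circ> g))\<^sup>2)"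
    unfolding energy_cayley coset comp_assoc by (rule sum.swap)
  also have "\<dots> \<le> energy (Sym (Suc n)) (cayley_kernel (Suc n)) F"
    unfolding energy_cayley
    by (rule sum_mono2[OF finite_R2 R2_mono[OF assms(1)]]) (simp add: sum_nonneg)
  finally show ?thesis .
qed

text \<open>The window misses the single point \<open>a\<close>, which forces \<open>n = 4\<close>
  and makes the cosets of its symmetric group fibres, where \<open>F\<close> is centred. The three
  generators of the class preserve these cosets, and \<open>symmetric_group_3_gap\<close> applies to
  each.\<close>

lemma balanced_energy_window:
  assumes F: "balanced n F" and T: "{1..n} = insert a {i, i + 1, i + 2}" "a \<notin> {i, i + 1, i + 2}"
    and i: "1 \<le> i" "Suc i < n"
  shows "4 * (\<Sum>g\<in>Sym n. (F g)\<^sup>2) \<le> (\<Sum>\<sigma>\<in>break_class n i (Suc i). \<Sum>g\<in>Sym n. (F g - F (\<sigma> \<circ> g))\<^sup>2)"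
proof -
  let ?T = "{i, i + 1, i + 2}"
  have fin: "finite ?T" by simp
  note coset = sum_permutes_coset[OF fin T(2), folded T(1)]
  have "4 * (\<Sum>g\<in>Sym n. (F g)\<^sup>2) = (\<Sum>b\<in>{1..n}. 4 * (\<Sum>h | h permutes ?T. (F (h \<circ> swap a b))\<^sup>2))"
    unfolding coset sum_distrib_left ..
  also have "\<dots> \<le> (\<Sum>b\<in>{1..n}.
      (\<Sum>h | h permutes ?T. (F (h \<circ> swap a b) - F (swap i (i + 2) \<circ> h \<circ> swap a b))\<^sup>2) +
      (\<Sum>h | h permutes ?T. (F (h \<circ> swap a b) - F (swap i (i + 1) \<circ> swap (i + 1) (i + 2) \<circ> h \<circ> swap a b))\<^sup>2) +
      (\<Sum>h | h permutes ?T. (F (h \<circ> swap a b) - F (swap i (i + 2) \<circ> swap (i + 1) (i + 2) \<circ> h \<circ> swap a b))\<^sup>2))"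
  proof (rule sum_mono)
    fix b assume "b \<in> {1..n}"
    then have "b \<in> insert a ?T" unfolding T(1) .
    from balanced_coset_sum[OF F T this]
    show "4 * (\<Sum>h | h permutes ?T. (F (h \<circ> swap a b))\<^sup>2) \<le>
      (\<Sum>h | h permutes ?T. (F (h \<circ> swap a b) - F (swap i (i + 2) \<circ> h \<circ> swap a b))\<^sup>2) +
      (\<Sum>h | h permutes ?T. (F (h \<circ> swap a b) - F (swap i (i + 1) \<circ> swap (i + 1) (i + 2) \<circ> h \<circ> swap a b))\<^sup>2) +
      (\<Sum>h | h permutes ?T. (F (h \<circ> swap a b) - F (swap i (i + 2) \<circ> swap (i + 1) (i + 2) \<circ> h \<circ> swap a b))\<^sup>2)"
      by (intro symmetric_group_3_gap[where \<Phi> = "\<lambda>h. F (h \<circ> swap a b)"]) auto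
  qed
  also have "\<dots> = (\<Sum>\<sigma>\<in>break_class n i (Suc i). \<Sum>g\<in>Sym n. (F g - F (\<sigma> \<circ> g))\<^sup>2)"
    unfolding sum_break_class_adjacent[OF i] coset comp_assoc by (simp only: sum.distrib)
  finally show ?thesis .
qed

lemma break_class_subset:
  assumes "n \<ge> 2" "i \<noteq> j"
  shows "break_class n i j \<subseteq> R2 n"
proof
  fix \<sigma> assume "\<sigma> \<in> break_class n i j"
  then show "\<sigma> \<in> R2 n"
    unfolding mem_maximally_reducible_perms_iff[OF assms(1)] break_class_def using assms(2) by simp
qed

text \<open>The windows starting at 1 and at 2 use disjoint sets of generators, so their bounds add
  up to 8, twice the gap.\<close>

lemma balanced_energy_4:
  assumes F: "balanced 4 F"
  shows "8 * (\<Sum>g\<in>Sym 4. (F g)\<^sup>2) \<le> energy (Sym 4) (cayley_kernel 4) F"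
proof -
  let ?E = "\<lambda>\<sigma>. \<Sum>g\<in>Sym 4. (F g - F (\<sigma> \<circ> g))\<^sup>2"
  have "4 * (\<Sum>g\<in>Sym 4. (F g)\<^sup>2) \<le> sum ?E (break_class 4 1 (Suc 1))"
    by (rule balanced_energy_window[OF F, of 4]) auto
  moreover have "4 * (\<Sum>g\<in>Sym 4. (F g)\<^sup>2) \<le> sum ?E (break_class 4 2 (Suc 2))"
    by (rule balanced_energy_window[OF F, of 1]) auto
  moreover have "sum ?E (break_class 4 1 (Suc 1)) + sum ?E (break_class 4 2 (Suc 2)) =
      sum ?E (break_class 4 1 (Suc 1) \<union> break_class 4 2 (Suc 2))"
    by (rule sum.union_disjoint[symmetric]) (auto simp: finite_break_class, auto simp: break_class_def doubleton_eq_iff)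
  moreover have "\<dots> \<le> sum ?E (R2 4)"
  proof (rule sum_mono2[OF finite_R2])
    show "break_class 4 1 (Suc 1) \<union> break_class 4 2 (Suc 2) \<subseteq> R2 4"
      by (intro Un_least break_class_subset) simp_all
  qed (simp add: sum_nonneg)
  ultimately show ?thesis unfolding energy_cayley by linarith
qed

lemma bij_betw_comp_permutes:
  assumes "\<sigma> permutes S"
  shows "bij_betw (\<lambda>g. \<sigma> \<circ> g) {g. g permutes S} {g. g permutes S}"
  by (rule bij_betw_byWitness[where f' = "\<lambda>g. Hilbert_Choice.inv \<sigma> \<circ> g"])
    (auto simp: comp_assoc[symmetric] permutes_inv_o[OF assms] permutes_compose permutes_inv assms)

text \<open>Left multiplication by \<sigma> carries the fibre over \<open>j\<close> onto the fibre
  over \<open>\<sigma> j\<close>, so summing over fibres commutes with the Laplacians.\<close>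

lemma fibre_sum_eigenfunction:
  assumes F: "centred_eigenfunction (Sym n) (cayley_kernel n) \<gamma> F"
    and i: "i \<in> {1..n}" and j: "j \<in> {1..n}" "fibre_sum n F i j \<noteq> 0"
  shows "centred_eigenfunction {1..n} (schreier_kernel n) \<gamma> (fibre_sum n F i)"
proof -
  have "sum (fibre_sum n F i) {1..n} = (\<Sum>g\<in>Sym n. \<Sum>j\<in>{1..n}. if g i = j then F g else 0)"
    unfolding fibre_sum_def by (rule sum.swap)
  also have "\<dots> = sum F (Sym n)"
    using i permutes_in_image[of _ "{1..n}" i] by (intro sum.cong refl) simp
  finally have zero: "sum (fibre_sum n F i) {1..n} = 0" using F by (simp add: centred_eigenfunction_def)
  have eigen: "laplacian {1..n} (schreier_kernel n) (fibre_sum n F i) j = \<gamma> * fibre_sum n F i j"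
    if j: "j \<in> {1..n}" for j
  proof -
    have shift: "fibre_sum n F i (\<sigma> j) = (\<Sum>g\<in>Sym n. if g i = j then F (\<sigma> \<circ> g) else 0)"
      if "\<sigma> \<in> R2 n" for \<sigma>
    proof -
      have \<sigma>: "\<sigma> permutes {1..n}" by (rule R2_permutes[OF that])
      have "fibre_sum n F i (\<sigma> j) = (\<Sum>g\<in>Sym n. if (\<sigma> \<circ> g) i = \<sigma> j then F (\<sigma> \<circ> g) else 0)"
        unfolding fibre_sum_def
        by (rule sum.reindex_bij_betw[OF bij_betw_comp_permutes[OF \<sigma>], symmetric])
      then show ?thesis by (simp add: inj_eq[OF permutes_inj[OF \<sigma>]])
    qed
    have "laplacian {1..n} (schreier_kernel n) (fibre_sum n F i) j =
        (\<Sum>\<sigma>\<in>R2 n. fibre_sum n F i j - fibre_sum n F i (\<sigma> j))"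
      unfolding schreier_kernel_def
      by (rule laplacian_action) (use finite_R2 R2_in_range j in auto)
    also have "\<dots> = (\<Sum>\<sigma>\<in>R2 n. \<Sum>g\<in>Sym n. if g i = j then F g - F (\<sigma> \<circ> g) else 0)"
      by (intro sum.cong refl) (simp add: shift, simp add: fibre_sum_def sum_subtractf[symmetric] if_distrib cong: if_cong)
    also have "\<dots> = (\<Sum>g\<in>Sym n. if g i = j then \<Sum>\<sigma>\<in>R2 n. F g - F (\<sigma> \<circ> g) else 0)"
      by (subst sum.swap) (intro sum.cong refl, simp)
    also have "\<dots> = (\<Sum>g\<in>Sym n. if g i = j then \<gamma> * F g else 0)"
    proof (intro sum.cong refl if_cong)
      fix g assume g: "g \<in> Sym n"
      have "laplacian (Sym n) (cayley_kernel n) F g = (\<Sum>\<sigma>\<in>R2 n. F g - F (\<sigma> \<circ> g))"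
        unfolding cayley_kernel_def
        by (rule laplacian_action) (use finite_R2 finite_Sym R2_comp_Sym g in blast)+
      then show "(\<Sum>\<sigma>\<in>R2 n. F g - F (\<sigma> \<circ> g)) = \<gamma> * F g"
        using F g by (simp add: centred_eigenfunction_def)
    qed
    also have "\<dots> = \<gamma> * fibre_sum n F i j"
      unfolding fibre_sum_def sum_distrib_left by (intro sum.cong refl) simp
    finally show ?thesis .
  qed
  show ?thesis using zero eigen j by (auto simp: centred_eigenfunction_def)
qed

text \<open>As \<open>(\<sigma> \<circ> g) 1 = \<sigma> (g 1)\<close>, the Laplacian commutes with
  the lift. All fibres of \<open>g \<mapsto> g 1\<close> have the same size, so the lift stays
  centred, and \<open>swap 1 j\<close> shows that every point is reached.\<close>

lemma schreier_eigenfunction_lift: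
  assumes "n \<ge> 1" and f: "centred_eigenfunction {1..n} (schreier_kernel n) \<gamma> f"
  shows "centred_eigenfunction (Sym n) (cayley_kernel n) \<gamma> (\<lambda>g. f (g 1))"
proof -
  have one: "1 \<in> {1..n}" using assms(1) by simp
  obtain j where j: "j \<in> {1..n}" "f j \<noteq> 0" using f by (auto simp: centred_eigenfunction_def)
  have "swap 1 j \<in> Sym n" using permutes_swap_id[OF one j(1)] by simp
  moreover have "f (swap 1 j 1) \<noteq> 0" using j by simp
  ultimately have nonzero: "\<exists>g\<in>Sym n. f (g 1) \<noteq> 0" by blast
  have ins: "{1..n} = insert 1 {2..n}" "1 \<notin> {2..n}" using assms(1) by auto
  have "(\<Sum>g\<in>Sym n. f (g 1)) =
      (\<Sum>b\<in>{1..n}. \<Sum>q | q permutes {2..n}. f ((swap 1 b \<circ> q) 1))"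
    using sum_over_permutations_insert[of "{2..n}" 1 "\<lambda>g. f (g 1)"] ins by simp
  also have "\<dots> = (\<Sum>b\<in>{1..n}. \<Sum>q | q permutes {2..n}. f b)"
    using ins(2) by (intro sum.cong refl) (simp add: permutes_not_in)
  also have "\<dots> = real (card {q. q permutes {2..n}}) * sum f {1..n}"
    by (simp add: sum_distrib_left)
  finally have zero: "(\<Sum>g\<in>Sym n. f (g 1)) = 0" using f by (simp add: centred_eigenfunction_def)
  have "laplacian (Sym n) (cayley_kernel n) (\<lambda>g. f (g 1)) g = \<gamma> * f (g 1)" if g: "g \<in> Sym n" for g
  proof -
    have g1: "g 1 \<in> {1..n}" using g permutes_in_image[of g "{1..n}" 1] one by blast
    have "laplacian (Sym n) (cayley_kernel n) (\<lambda>g. f (g 1)) g = (\<Sum>\<sigma>\<in>R2 n. f (g 1) - f ((\<sigma> \<circ> g) 1))"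
      unfolding cayley_kernel_def
      by (rule laplacian_action) (use finite_R2 finite_Sym R2_comp_Sym g in blast)+
    also have "\<dots> = laplacian {1..n} (schreier_kernel n) f (g 1)"
      unfolding schreier_kernel_def
      by (subst laplacian_action) (use finite_R2 R2_in_range g1 in auto)
    also have "\<dots> = \<gamma> * f (g 1)" using f g1 unfolding centred_eigenfunction_def by blast
    finally show ?thesis .
  qed
  with nonzero zero show ?thesis by (simp add: centred_eigenfunction_def)
qed

text \<open>A lowest Cayley eigenfunction either has a nonzero fibre sum, and then its eigenvalue
  occurs in the Schreier graph, or is balanced and subject to \<open>bal\<close>. Both cases give
  \<open>\<gamma> \<le> \<delta>\<close>, and the lift shows that \<gamma> is attained.\<close>

lemma cayley_gap_if_balanced:
  assumes n: "n \<ge> 2" and gap: "spectral_gap {1..n} (schreier_kernel n) \<gamma>"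
    and bal: "\<And>F. balanced n F \<Longrightarrow> 2 * \<gamma> * (\<Sum>g\<in>Sym n. (F g)\<^sup>2) \<le> energy (Sym n) (cayley_kernel n) F"
  shows "spectral_gap (Sym n) (cayley_kernel n) \<gamma>"
proof -
  have id: "id \<in> Sym n" by (simp add: permutes_id)
  have swap: "swap 1 2 \<in> Sym n" using n by (simp add: permutes_swap_id)
  have "swap 1 2 (1 :: nat) \<noteq> id 1" by simp
  then have "id \<noteq> (swap 1 2 :: nat \<Rightarrow> nat)" by metis
  then obtain \<delta> where \<delta>: "spectral_gap (Sym n) (cayley_kernel n) \<delta>"
    using spectral_gap_exists[where a = "cayley_kernel n", OF finite_Sym id swap _ cayley_kernel_sym[OF n]] by blast
  then obtain F where F: "centred_eigenfunction (Sym n) (cayley_kernel n) \<delta> F"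
    by (auto simp: spectral_gap_def)
  have "\<gamma> \<le> \<delta>"
  proof (cases "balanced n F")
    case True
    have "energy (Sym n) (cayley_kernel n) F = 2 * \<delta> * (\<Sum>g\<in>Sym n. (F g)\<^sup>2)"
      by (rule energy_eigenfunction[where a = "cayley_kernel n", OF cayley_kernel_sym[OF n] F])
    with bal[OF True] have "2 * \<gamma> * (\<Sum>g\<in>Sym n. (F g)\<^sup>2) \<le> 2 * \<delta> * (\<Sum>g\<in>Sym n. (F g)\<^sup>2)" by simp
    moreover obtain g where "g \<in> Sym n" "F g \<noteq> 0" using F unfolding centred_eigenfunction_def by blast
    then have "0 < (\<Sum>g\<in>Sym n. (F g)\<^sup>2)" by (rule sum_square_pos[OF finite_Sym])
    ultimately show ?thesis by simp
  next
    case False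
    then obtain i j where ij: "i \<in> {1..n}" "j \<in> {1..n}" "fibre_sum n F i j \<noteq> 0"
      by (auto simp: balanced_def)
    show ?thesis
      by (rule eigenvalue_ge_gap[where a = "schreier_kernel n", OF _ schreier_kernel_sym[OF n] gap fibre_sum_eigenfunction[OF F ij]]) simp
  qed
  have "2 * \<gamma> * (\<Sum>g\<in>Sym n. (H g)\<^sup>2) \<le> energy (Sym n) (cayley_kernel n) H" if "sum H (Sym n) = 0" for H
  proof -
    have "2 * \<gamma> * (\<Sum>g\<in>Sym n. (H g)\<^sup>2) \<le> 2 * \<delta> * (\<Sum>g\<in>Sym n. (H g)\<^sup>2)"
      using \<open>\<gamma> \<le> \<delta>\<close> by (intro mult_right_mono sum_nonneg) auto
    also have "\<dots> \<le> energy (Sym n) (cayley_kernel n) H" using \<delta> that unfolding spectral_gap_def by blast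
    finally show ?thesis .
  qed
  moreover obtain f where "centred_eigenfunction {1..n} (schreier_kernel n) \<gamma> f"
    using gap by (auto simp: spectral_gap_def)
  then have "centred_eigenfunction (Sym n) (cayley_kernel n) \<gamma> (\<lambda>g. f (g 1))"
    using n by (intro schreier_eigenfunction_lift) auto
  ultimately show ?thesis unfolding spectral_gap_def by blast
qed

lemma cayley_gap_eq_schreier_gap:
  assumes "n \<ge> 4" and "spectral_gap {1..n} (schreier_kernel n) \<gamma>"
  shows "spectral_gap (Sym n) (cayley_kernel n) \<gamma>"
  using assms
proof (induction n arbitrary: \<gamma> rule: nat_induct_at_least)
  case base
  show ?case
  proof (rule cayley_gap_if_balanced[OF _ base])
    fix F assume F: "balanced 4 F"
    have "2 * \<gamma> * (\<Sum>g\<in>Sym 4. (F g)\<^sup>2) \<le> 8 * (\<Sum>g\<in>Sym 4. (F g)\<^sup>2)"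
      using schreier_gap_4(1)[OF base] by (intro mult_right_mono sum_nonneg) auto
    with balanced_energy_4[OF F]
    show "2 * \<gamma> * (\<Sum>g\<in>Sym 4. (F g)\<^sup>2) \<le> energy (Sym 4) (cayley_kernel 4) F" by linarith
  qed simp
next
  case (Suc n)
  obtain \<delta> where \<delta>: "spectral_gap {1..n} (schreier_kernel n) \<delta>"
    using schreier_gap_exists[of n] Suc.hyps by auto
  show ?case
  proof (rule cayley_gap_if_balanced[OF _ Suc.prems])
    fix F assume F: "balanced (Suc n) F"
    have "2 * \<gamma> * (\<Sum>g\<in>Sym (Suc n). (F g)\<^sup>2) \<le> 2 * \<delta> * (\<Sum>g\<in>Sym (Suc n). (F g)\<^sup>2)"
      using schreier_gap_antimono[OF Suc.hyps \<delta> Suc.prems] by (intro mult_right_mono sum_nonneg) auto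
    also have "\<dots> \<le> energy (Sym (Suc n)) (cayley_kernel (Suc n)) F"
      using Suc.hyps by (intro balanced_energy_Suc[OF _ Suc.IH[OF \<delta>] F]) simp
    finally show "2 * \<gamma> * (\<Sum>g\<in>Sym (Suc n). (F g)\<^sup>2) \<le> energy (Sym (Suc n)) (cayley_kernel (Suc n)) F" .
  qed (use Suc.hyps in simp)
qed

section \<open>Degrees, arc counts and the second-largest eigenvalues\<close>

lemma sum_schreier_kernel:
  assumes "i \<in> {1..n}"
  shows "(\<Sum>j=1..n. schreier_kernel n i j) = real (card (R2 n))"
  unfolding schreier_kernel_def
  using sum_action_kernel[of "{1..n}" "R2 n" "\<lambda>\<sigma> i. \<sigma> i" i "\<lambda>_. 1"] finite_R2 R2_in_range assms by simp

lemma sum_cayley_kernel: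
  assumes "g \<in> Sym n"
  shows "(\<Sum>h\<in>Sym n. cayley_kernel n g h) = real (card (R2 n))"
proof -
  have "(\<Sum>h\<in>Sym n. action_kernel (R2 n) (\<lambda>\<sigma> g. \<sigma> \<circ> g) g h * 1) = (\<Sum>\<sigma>\<in>R2 n. 1)"
    by (rule sum_action_kernel[OF finite_Sym finite_R2]) (rule R2_comp_Sym[OF _ assms])
  then show ?thesis by (simp add: cayley_kernel_def)
qed

lemma schreier_graph_arcs:
  assumes "i \<in> {1..n}"
  shows "card {e \<in> arcs (schreier_graph n S). tail (schreier_graph n S) e = i \<and> head (schreier_graph n S) e = j} =
    card {\<sigma> \<in> S. \<sigma> i = j}"
proof -
  have "{e \<in> arcs (schreier_graph n S). tail (schreier_graph n S) e = i \<and> head (schreier_graph n S) e = j} =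
      Pair i ` {\<sigma> \<in> S. \<sigma> i = j}"
    using assms by (auto simp: schreier_graph_def)
  then show ?thesis by (simp add: card_image inj_on_def)
qed

text \<open>Parallel arcs are merged in the Cayley graph, but by right cancellation at most one
  generator leads from \<open>g\<close> to \<open>h\<close>, so the two counts agree.\<close>

lemma cayley_graph_arcs:
  fixes n :: nat and S :: "(nat \<Rightarrow> nat) set"
  defines "C \<equiv> with_proj (cayley_graph (sym_group n) S)"
  assumes g: "g \<in> Sym n" and h: "h \<in> Sym n"
  shows "card {e \<in> arcs C. tail C e = g \<and> head C e = h} = card {\<sigma> \<in> S. \<sigma> \<circ> g = h}"
proof (cases "\<exists>\<sigma>\<in>S. h = \<sigma> \<circ> g")
  case True
  then obtain \<tau> where \<tau>: "\<tau> \<in> S" "h = \<tau> \<circ> g" by blast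
  have "\<sigma> = \<tau>" if "\<sigma> \<circ> g = h" for \<sigma>
    using that \<tau> permutes_surj[of g "{1..n}"] g by (metis mem_Collect_eq surj_fun_eq)
  then have "{\<sigma> \<in> S. \<sigma> \<circ> g = h} = {\<tau>}" using \<tau> by blast
  moreover have "{e \<in> arcs C. tail C e = g \<and> head C e = h} = {(g, h)}"
    using True g h by (auto simp: C_def cayley_graph_def sym_group_def)
  ultimately show ?thesis by simp
next
  case False
  then have "{e \<in> arcs C. tail C e = g \<and> head C e = h} = {}" "{\<sigma> \<in> S. \<sigma> \<circ> g = h} = {}"
    by (auto simp: C_def cayley_graph_def sym_group_def)
  then show ?thesis by (simp only: card.empty)
qed

lemma second_largest_eigenvalue_schreier:
  assumes "n \<ge> 2" and gap: "spectral_gap {1..n} (schreier_kernel n) \<gamma>"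
  shows "second_largest_eigenvalue (schreier_graph n (R2 n)) = real (card (R2 n)) - \<gamma>"
proof -
  let ?G = "schreier_graph n (R2 n)"
  have V: "verts ?G = {1..n}" by (simp add: schreier_graph_def)
  have kernel: "real (card {e \<in> arcs ?G. tail ?G e = i \<and> head ?G e = j}) = schreier_kernel n i j"
    if "i \<in> {1..n}" for i j
    using schreier_graph_arcs[OF that] by (simp add: schreier_kernel_def action_kernel_def)
  show ?thesis
  proof (rule second_largest_eigenvalue_eq, unfold V)
    show "finite {1..n}" by simp
    show "spectral_gap {1..n} (\<lambda>i j. real (card {e \<in> arcs ?G. tail ?G e = i \<and> head ?G e = j})) \<gamma>"
      using gap by (subst spectral_gap_cong[where b = "schreier_kernel n"]) (rule kernel)
    fix i assume i: "i \<in> {1..n}"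
    show "(\<Sum>j=1..n. real (card {e \<in> arcs ?G. tail ?G e = i \<and> head ?G e = j})) = real (card (R2 n))"
      unfolding sum_schreier_kernel[OF i, symmetric] by (rule sum.cong[OF refl kernel[OF i]])
    fix j assume j: "j \<in> {1..n}"
    show "real (card {e \<in> arcs ?G. tail ?G e = i \<and> head ?G e = j}) =
        real (card {e \<in> arcs ?G. tail ?G e = j \<and> head ?G e = i})"
      unfolding kernel[OF i] kernel[OF j] by (rule schreier_kernel_sym[OF assms(1)])
  qed
qed

lemma second_largest_eigenvalue_cayley:
  assumes "n \<ge> 2" and gap: "spectral_gap (Sym n) (cayley_kernel n) \<gamma>"
  shows "second_largest_eigenvalue (with_proj (cayley_graph (sym_group n) (R2 n))) = real (card (R2 n)) - \<gamma>"
proof -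
  let ?C = "with_proj (cayley_graph (sym_group n) (R2 n))"
  have V: "verts ?C = Sym n" by (simp add: cayley_graph_def sym_group_def)
  have kernel: "real (card {e \<in> arcs ?C. tail ?C e = g \<and> head ?C e = h}) = cayley_kernel n g h"
    if "g \<in> Sym n" "h \<in> Sym n" for g h
    using cayley_graph_arcs[OF that] by (simp add: cayley_kernel_def action_kernel_def)
  show ?thesis
  proof (rule second_largest_eigenvalue_eq, unfold V)
    show "finite (Sym n)" by (rule finite_Sym)
    show "spectral_gap (Sym n) (\<lambda>g h. real (card {e \<in> arcs ?C. tail ?C e = g \<and> head ?C e = h})) \<gamma>"
      using gap by (subst spectral_gap_cong[where b = "cayley_kernel n"]) (rule kernel)
    fix g assume g: "g \<in> Sym n"
    show "(\<Sum>h\<in>Sym n. real (card {e \<in> arcs ?C. tail ?C e = g \<and> head ?C e = h})) = real (card (R2 n))"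
      unfolding sum_cayley_kernel[OF g, symmetric] by (rule sum.cong[OF refl kernel[OF g]])
    fix h assume h: "h \<in> Sym n"
    show "real (card {e \<in> arcs ?C. tail ?C e = g \<and> head ?C e = h}) =
        real (card {e \<in> arcs ?C. tail ?C e = h \<and> head ?C e = g})"
      unfolding kernel[OF g h] kernel[OF h g] by (rule cayley_kernel_sym[OF assms(1)])
  qed
qed

theorem theorem1p1:
  fixes n :: nat
  assumes "n \<ge> 4"
  shows "digraph_iso (with_proj (FJ n 2))
           (with_proj (cayley_graph (sym_group n) (maximally_reducible_perms n 2))) \<and>
         aldous_property n (maximally_reducible_perms n 2)"
proof
  show "digraph_iso (with_proj (FJ n 2))
      (with_proj (cayley_graph (sym_group n) (maximally_reducible_perms n 2)))"
    using assms by (intro FJ_iso_cayley_graph) simp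
  have "n \<ge> 2" using assms by simp
  then obtain \<gamma> where \<gamma>: "spectral_gap {1..n} (schreier_kernel n) \<gamma>"
    using schreier_gap_exists by blast
  then show "aldous_property n (maximally_reducible_perms n 2)"
    using second_largest_eigenvalue_schreier[OF \<open>n \<ge> 2\<close> \<gamma>]
      second_largest_eigenvalue_cayley[OF \<open>n \<ge> 2\<close> cayley_gap_eq_schreier_gap[OF assms \<gamma>]]
    by (simp add: aldous_property_def)
qed

end
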